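(* Let $(X,\varphi)$ be a bounded $N$-dimensional Lattice EDS, let $\beta=\sup_{u\in X} b(\|e_u\|_\infty)$ (so that $|f|^2\le\beta d$), let $u\in X$, $u(t)=\varphi(u,t)$, $e_0=\|e_{u(0)}\|_\infty$, and for an integer $R\ge1$ and $T>0$ let $$F(R,T)=\int_0^T\sum_{\alpha\in\partial C^*(R)} f_{u(t)}(\alpha)\cdot n^*(\alpha)\,dt .$$ Then for every integer $R\geq 1$: (i) if $N=1$, then $\limsup_{T\to\infty}\frac1{\sqrt T}F(R,T)\le2\sqrt{\beta e_0}$; (ii) if $N=2$, then $\limsup_{T\to\infty}\frac{\log T}{T}F(R,T)\le96\sqrt2\,\beta$; (iii) if $N\ge3$, then $\limsup_{T\to\infty}\frac1TF(R,T)\le N^{5/2}2^{2N-2}\,\beta R^{N-2}$.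
   Context: Notation: $\varepsilon_1,\dots,\varepsilon_N$ is the standard basis of $\mathbb{Z}^N$; for $v:\mathbb{Z}^N\to\mathbb{R}^N$, $\operatorname{div} v(\alpha)=\sum_{j=1}^N \big(v_j(\alpha)-v_j(\alpha-\varepsilon_j)\big)$; $l_\infty(\mathbb{Z}^N)$ is the space of bounded functions $\mathbb{Z}^N\to\mathbb{R}$ with sup-norm $\|\cdot\|_\infty$; $\mathbb{R}^+=[0,\infty)$. Cubes, for integer $r\geq 1$: $C^*(r)=\{\alpha\in\mathbb{Z}^N: -r+1\le \alpha_j\le r,\ j=1,\dots,N\}$; $\partial C^*(r)=\{\alpha\in\mathbb{Z}^N: |\alpha_j|\le r \text{ for all } j,\ |\alpha_k|=r\text{ for some }k\}$. The normal vector $n^*:\partial C^*(r)\to\mathbb{R}^N$ is: $n^*(\alpha)=\sum_{i=1}^k\varepsilon_{j_i}$ if $\alpha_{j_1}=\dots=\alpha_{j_k}=r$ ($k\ge1$) and all other coordinates satisfy $-r+1\le\alpha_j\le r-1$; $n^*(\alpha)=-\varepsilon_k$ if $\alpha_k=-r$ and all other coordinates satisfy $-r+1\le\alpha_j\le r$; $n^*(\alpha)=0$ otherwise. Definition (Lattice EDS). Let $X$ be a metrizable space and $\varphi$ a continuous semiflow on $X$; write $u(t)=\varphi(u,t)$, $t\ge 0$. A point $u\in X$ is stationary (an equilibrium) if $\varphi(u,t)=u$ for all $t\ge 0$. $(X,\varphi)$ is an $N$-dimensional extended dissipative system on a lattice (Lattice EDS) if there are functions $e,d,f_1,\dots,f_N:X\to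 l_\infty(\mathbb{Z}^N)$ (energy, dissipation, flux $f=(f_1,\dots,f_N)$), written $u\mapsto e_u,d_u,f_u$, fixed once and for all, such that: (A1) $e_u(\alpha)\ge 0$, $d_u(\alpha)\geq 0$ for all $u\in X$, $\alpha\in\mathbb{Z}^N$. (A2) For each $\alpha$, the maps $u\mapsto e_u(\alpha),d_u(\alpha),(f_1)_u(\alpha),\dots,(f_N)_u(\alpha)$ are continuous $X\to\mathbb{R}$; and for each $u\in X$ the maps $t\mapsto\|e_{u(t)}\|_\infty,\|d_{u(t)}\|_\infty,\|f_{u(t)}\|_\infty$ are continuous $\mathbb{R}^+\to\mathbb{R}^+$. (A3) If $d_u\equiv 0$ then $u$ is stationary. (A4) Along each semiorbit $u(t)$ and at each $\alpha$, $\partial_t e_{u(t)}(\alpha)=-d_{u(t)}(\alpha)+\operatorname{div} f_{u(t)}(\alpha)$, with $\partial_t$ in the sense of distributions. (A5) There is a non-decreasing $b:\mathbb{R}^+\to\mathbb{R}^+$ such that $|f_u(\alpha)|^2\le b(\|e_u\|_\infty)\, d_u(\alpha)$ for all $u\in X$, $\alpha\in\mathbb{Z}^N$. The Lattice EDS is bounded if $\sup_{u\in X}\|e_u\|_\infty<\infty$. *)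

theory Defs
  imports "HOL-Analysis.Analysis"
begin

text \<open>
  The lattice \<open>\<int>\<^sup>N\<close> is \<^typ>\<open>int ^ 'n\<close> with \<open>N = CARD('n)\<close>, and its standard basis vectors are
  \<^term>\<open>axis j (1::int)\<close>. As this type is discrete, every function on it is continuous; hence
  \<open>l\<^sub>\<infinity>(\<int>\<^sup>N)\<close> with the sup-norm is the library type \<^typ>\<open>(int ^ 'n) \<Rightarrow>\<^sub>C real\<close> with its norm.
\<close>

lemma continuous_on_lattice: "continuous_on S (g :: int ^ 'n \<Rightarrow> 'b::topological_space)"
proof -
  have "open {x}" for x :: "int ^ 'n"
  proof -
    have "{x} = {y. \<forall>i. y $ i \<in> {x $ i}}"
      by (auto simp: vec_eq_iff)
    also have "open \<dots>"
      unfolding open_vec_def by (auto intro!: exI[where x = "\<lambda>i. {x $ i}"] open_discrete simp: vec_eq_iff)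
    finally show ?thesis .
  qed
  then have "open A" for A :: "(int ^ 'n) set"
    using open_Union[of "(\<lambda>x. {x}) ` A"] by auto
  then show ?thesis
    by (auto simp: continuous_on_open_invariant)
qed

lemma bcontfun_lattice:
  "(bcontfun :: (int ^ 'n \<Rightarrow> 'b::metric_space) set) = {g. bounded (range g)}"
  by (simp add: bcontfun_def continuous_on_lattice)

definition lattice_div :: "(int ^ 'n \<Rightarrow> real ^ 'n) \<Rightarrow> int ^ 'n \<Rightarrow> real" where
  "lattice_div v \<alpha> = (\<Sum>j\<in>UNIV. v \<alpha> $ j - v (\<alpha> - axis j 1) $ j)"

definition cube_boundary :: "int \<Rightarrow> (int ^ 'n) set" where
  "cube_boundary r = {\<alpha>. (\<forall>j. \<bar>\<alpha> $ j\<bar> \<le> r) \<and> (\<exists>k. \<bar>\<alpha> $ k\<bar> = r)}"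

definition cube_normal :: "int \<Rightarrow> int ^ 'n \<Rightarrow> real ^ 'n" where
  "cube_normal r \<alpha> =
    (if (\<exists>k. \<alpha> $ k = r) \<and> (\<forall>j. \<alpha> $ j \<noteq> r \<longrightarrow> - r + 1 \<le> \<alpha> $ j \<and> \<alpha> $ j \<le> r - 1)
     then \<Sum>k | \<alpha> $ k = r. axis k 1
     else if \<exists>k. \<alpha> $ k = - r \<and> (\<forall>j. j \<noteq> k \<longrightarrow> - r + 1 \<le> \<alpha> $ j \<and> \<alpha> $ j \<le> r)
     then - axis (THE k. \<alpha> $ k = - r) 1
     else 0)"

definition test_function :: "real set \<Rightarrow> (real \<Rightarrow> real) \<Rightarrow> bool" where
  "test_function S \<psi> \<longleftrightarrow>
     (\<forall>k t. (deriv ^^ k) \<psi> field_differentiable at t) \<and>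
     compact (closure {t. \<psi> t \<noteq> 0}) \<and> closure {t. \<psi> t \<noteq> 0} \<subseteq> S"

text \<open>
  \<open>g' = h\<close> in the sense of distributions on the open set \<open>S\<close>. Intended for locally integrable
  \<open>g\<close> and \<open>h\<close>; it is used below only for functions continuous in time.
\<close>

definition has_distributional_derivative_on ::
    "(real \<Rightarrow> real) \<Rightarrow> (real \<Rightarrow> real) \<Rightarrow> real set \<Rightarrow> bool" where
  "has_distributional_derivative_on g h S \<longleftrightarrow>
     (\<forall>\<psi>. test_function S \<psi> \<longrightarrow>
        integral S (\<lambda>t. h t * \<psi> t) = - integral S (\<lambda>t. g t * deriv \<psi> t))"

locale continuous_semiflow =
  fixes X :: "'x topology" and \<phi> :: "'x \<Rightarrow> real \<Rightarrow> 'x"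
  assumes continuous:
      "continuous_map (prod_topology X (top_of_set {0..})) X (\<lambda>(u, t). \<phi> u t)"
    and initial: "u \<in> topspace X \<Longrightarrow> \<phi> u 0 = u"
    and semigroup: "u \<in> topspace X \<Longrightarrow> 0 \<le> s \<Longrightarrow> 0 \<le> t \<Longrightarrow> \<phi> u (s + t) = \<phi> (\<phi> u s) t"

definition stationary :: "('x \<Rightarrow> real \<Rightarrow> 'x) \<Rightarrow> 'x \<Rightarrow> bool" where
  "stationary \<phi> u \<longleftrightarrow> (\<forall>t\<ge>0. \<phi> u t = u)"

text \<open>
  The flux components are collected into one vector-valued function, so \<^term>\<open>norm (f u)\<close> is the
  supremum over the lattice of the Euclidean norm of \<^term>\<open>f u \<alpha>\<close>. The function \<open>b\<close> is made a parameter,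
  because the constants in the flux estimates depend on it.
\<close>

locale lattice_EDS = continuous_semiflow X \<phi>
  for X :: "'x topology" and \<phi> :: "'x \<Rightarrow> real \<Rightarrow> 'x" +
  fixes e d :: "'x \<Rightarrow> ((int ^ 'n::finite) \<Rightarrow>\<^sub>C real)"
    and f :: "'x \<Rightarrow> ((int ^ 'n::finite) \<Rightarrow>\<^sub>C (real ^ 'n))"
    and b :: "real \<Rightarrow> real"
  assumes metrizable: "metrizable_space X"
    and energy_nonneg: "u \<in> topspace X \<Longrightarrow> 0 \<le> e u \<alpha>"
    and dissipation_nonneg: "u \<in> topspace X \<Longrightarrow> 0 \<le> d u \<alpha>"
    and continuous_energy: "continuous_map X euclidean (\<lambda>u. e u \<alpha>)"
    and continuous_dissipation: "continuous_map X euclidean (\<lambda>u. d u \<alpha>)"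
    and continuous_flux: "continuous_map X euclidean (\<lambda>u. f u \<alpha> $ j)"
    and continuous_norm_energy: "u \<in> topspace X \<Longrightarrow> continuous_on {0..} (\<lambda>t. norm (e (\<phi> u t)))"
    and continuous_norm_dissipation: "u \<in> topspace X \<Longrightarrow> continuous_on {0..} (\<lambda>t. norm (d (\<phi> u t)))"
    and continuous_norm_flux: "u \<in> topspace X \<Longrightarrow> continuous_on {0..} (\<lambda>t. norm (f (\<phi> u t)))"
    and no_dissipation_stationary:
      "u \<in> topspace X \<Longrightarrow> (\<forall>\<alpha>. d u \<alpha> = 0) \<Longrightarrow> stationary \<phi> u"
    and energy_balance: "u \<in> topspace X \<Longrightarrow>
      has_distributional_derivative_on (\<lambda>t. e (\<phi> u t) \<alpha>)
        (\<lambda>t. - d (\<phi> u t) \<alpha> + lattice_div (f (\<phi> u t)) \<alpha>) {0<..}"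
    and b_mono: "mono_on {0..} b"
    and b_nonneg: "0 \<le> x \<Longrightarrow> 0 \<le> b x"
    and flux_bound: "u \<in> topspace X \<Longrightarrow> (norm (f u \<alpha>))\<^sup>2 \<le> b (norm (e u)) * d u \<alpha>"

locale bounded_lattice_EDS = lattice_EDS +
  assumes bounded_energy: "bdd_above ((\<lambda>u. norm (e u)) ` topspace X)"

definition boundary_flux ::
    "('x \<Rightarrow> real \<Rightarrow> 'x) \<Rightarrow> ('x \<Rightarrow> ((int ^ 'n) \<Rightarrow>\<^sub>C (real ^ 'n))) \<Rightarrow> 'x \<Rightarrow> int \<Rightarrow> real \<Rightarrow> real" where
  "boundary_flux \<phi> f u R T =
     integral {0..T} (\<lambda>t. \<Sum>\<alpha>\<in>cube_boundary R. f (\<phi> u t) \<alpha> \<bullet> cube_normal R \<alpha>)"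

end

theory Submission
  imports Defs "HOL-Computational_Algebra.Polynomial" "HOL-Real_Asymp.Real_Asymp"
begin

text \<open>
  Let \<open>\<theta> > 0\<close> be a summable cutoff on the lattice with \<open>\<theta> = 1\<close> on \<open>C\<^sup>*(R)\<close> and its forward neighbours.
  Testing the energy balance outside the cube against \<open>\<theta>\<close> expresses the flux through the boundary
  of the cube as a sum of \<open>f \<cdot> (- \<nabla>\<theta>)\<close>, minus the dissipation and the change of energy weighted by
  \<open>\<theta>\<close>. By Young's inequality and \<open>|f|\<^sup>2 \<le> \<beta> d\<close> the dissipation absorbs the gradient term up to
  \<open>\<beta>/4 \<cdot> |\<nabla>\<theta>|\<^sup>2 / \<theta>\<close>, so that
  \<open>F(R,T) \<le> \<beta> T / 4 \<cdot> \<Sum> |\<nabla>\<theta>|\<^sup>2 / \<theta> + e\<^sub>0 \<Sum> \<theta>\<close>.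
  In dimension one and in dimension at least three, \<open>\<theta>\<close> is a product of one-dimensional profiles
  with geometric tails of mass \<open>\<tau>\<close>, where \<open>\<tau>\<close> is proportional to \<open>\<surd>T\<close> resp. equal to \<open>R - 1/2\<close>.
  In dimension two, \<open>\<theta>\<close> is the square of a function of \<open>max |\<alpha>\<^sub>j|\<close> that decays logarithmically up
  to the scale \<open>T\<^bsup>9/20\<^esup>\<close>.
\<close>

section \<open>Distributional derivatives of continuous functions\<close>

text \<open>Two quantities of the cutoff compete: the cost
  \<open>\<Sum> |\<nabla>\<theta>|\<^sup>2 / \<theta>\<close>, which is multiplied by T, and the
  mass \<open>\<Sum> \<theta>\<close>, which is not. With \<open>\<theta> = \<chi>\<^sup>2\<close>
  the cost becomes, up to a factor, the Dirichlet energy of \<open>\<chi>\<close>, so for a cutoff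
  of scale M the best cost is a capacity of the cube, against a mass of order M^N. In dimension one
  the capacity is of order 1/M, and balancing T/M against M gives sqrt T. In the plane it is of
  order 1/log M, so M may be a power of T with any exponent below 1/2, and the exponent affects only
  the constant. From dimension three on it does not tend to 0, so up to constants nothing beats a
  fixed multiple of R, and the bound is linear in T.

  Two obstacles shape the rest. The cost divides by \<theta>, so \<theta> is positive everywhere;
  the sums are truncated to boxes, and the truncation error is removed at fixed T by summability.
  The energy balance holds only in the sense of distributions, so an integrated identity is derived
  first, which requires a supply of test functions.\<close>

definition smooth :: "(real \<Rightarrow> real) \<Rightarrow> bool" where
  "smooth \<psi> \<longleftrightarrow> (\<forall>k t. (deriv ^^ k) \<psi> field_differentiable at t)"

text \<open>Iterated derivatives never leave a set each of whose members has a derivative in the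
  set, so no formula for the k-th derivative is needed.\<close>

lemma smooth_coinduct:
  assumes "\<psi> \<in> S"
    and step: "\<And>\<psi>. \<psi> \<in> S \<Longrightarrow> \<exists>\<psi>'\<in>S. \<forall>t. (\<psi> has_field_derivative \<psi>' t) (at t)"
  shows "smooth \<psi>"
proof -
  have "(deriv ^^ k) \<psi> \<in> S" for k
  proof (induction k)
    case 0
    then show ?case using assms(1) by simp
  next
    case (Suc k)
    then obtain \<psi>' where "\<psi>' \<in> S" "\<forall>t. ((deriv ^^ k) \<psi> has_field_derivative \<psi>' t) (at t)"
      using step by blast
    then have "deriv ((deriv ^^ k) \<psi>) = \<psi>'"
      by (auto simp: fun_eq_iff intro!: DERIV_imp_deriv)
    with \<open>\<psi>' \<in> S\<close> show ?case by simp
  qed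
  then show ?thesis
    unfolding smooth_def using step field_differentiable_def by blast
qed

lemma smooth_has_derivative: "smooth \<psi> \<Longrightarrow> (\<psi> has_field_derivative deriv \<psi> t) (at t)"
  unfolding smooth_def by (metis DERIV_deriv_iff_field_differentiable funpow_0)

lemma smooth_deriv: "smooth \<psi> \<Longrightarrow> smooth (deriv \<psi>)"
  unfolding smooth_def by (metis funpow_Suc_right o_apply)

lemma smooth_antiderivative:
  assumes "\<And>t. (\<psi> has_field_derivative \<psi>' t) (at t)" "smooth \<psi>'"
  shows "smooth \<psi>"
proof (rule smooth_coinduct[of _ "insert \<psi> (Collect smooth)"])
  fix \<eta> assume "\<eta> \<in> insert \<psi> (Collect smooth)"
  then consider "\<eta> = \<psi>" | "smooth \<eta>" by auto
  then show "\<exists>\<eta>'\<in>insert \<psi> (Collect smooth). \<forall>t. (\<eta> has_field_derivative \<eta>' t) (at t)"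
  proof cases
    case 1
    then show ?thesis using assms by blast
  next
    case 2
    then show ?thesis using smooth_deriv smooth_has_derivative by blast
  qed
qed auto

lemma smooth_continuous_on: "smooth \<psi> \<Longrightarrow> continuous_on S \<psi>"
  by (meson DERIV_isCont continuous_at_imp_continuous_on smooth_has_derivative)

lemma smooth_diff:
  assumes "smooth u" "smooth v"
  shows "smooth (\<lambda>t. u t - v t)"
proof (rule smooth_coinduct[of _ "{\<lambda>t. u t - v t | u v. smooth u \<and> smooth v}"])
  fix \<psi> assume "\<psi> \<in> {\<lambda>t. u t - v t | u v. smooth u \<and> smooth v}"
  then obtain u v where *: "\<psi> = (\<lambda>t. u t - v t)" "smooth u" "smooth v" by auto
  then have "\<forall>t. (\<psi> has_field_derivative (deriv u t - deriv v t)) (at t)"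
    by (auto intro!: DERIV_diff smooth_has_derivative)
  then show "\<exists>\<psi>'\<in>{\<lambda>t. u t - v t | u v. smooth u \<and> smooth v}. \<forall>t. (\<psi> has_field_derivative \<psi>' t) (at t)"
    using smooth_deriv[OF *(2)] smooth_deriv[OF *(3)]
    by (intro bexI[of _ "\<lambda>t. deriv u t - deriv v t"]) auto
qed (use assms in auto)

text \<open>Products alone are not stable under differentiation, but sums of products are, by the
  product rule. This replaces the Leibniz formula.\<close>

inductive_set smooth_products :: "(real \<Rightarrow> real) set" where
  mult: "smooth u \<Longrightarrow> smooth v \<Longrightarrow> (\<lambda>t. u t * v t) \<in> smooth_products"
| add: "u \<in> smooth_products \<Longrightarrow> v \<in> smooth_products \<Longrightarrow> (\<lambda>t. u t + v t) \<in> smooth_products"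

lemma smooth_mult:
  assumes "smooth u" "smooth v"
  shows "smooth (\<lambda>t. u t * v t)"
proof (rule smooth_coinduct[of _ smooth_products])
  fix \<psi> assume "\<psi> \<in> smooth_products"
  then show "\<exists>\<psi>'\<in>smooth_products. \<forall>t. (\<psi> has_field_derivative \<psi>' t) (at t)"
  proof induction
    case (mult u v)
    have "((\<lambda>t. u t * v t) has_field_derivative (deriv u t * v t + deriv v t * u t)) (at t)" for t
      using mult by (intro DERIV_mult smooth_has_derivative)
    moreover have "(\<lambda>t. deriv u t * v t + deriv v t * u t) \<in> smooth_products"
      using mult by (intro smooth_products.intros smooth_deriv)
    ultimately show ?case
      by (intro bexI[of _ "\<lambda>t. deriv u t * v t + deriv v t * u t"]) auto
  next
    case (add u v)
    then obtain u' v' where "u' \<in> smooth_products" "v' \<in> smooth_products"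
      "\<forall>t. (u has_field_derivative u' t) (at t)" "\<forall>t. (v has_field_derivative v' t) (at t)"
      by blast
    then show ?case
      by (intro bexI[of _ "\<lambda>t. u' t + v' t"]) (auto intro!: derivative_intros smooth_products.add)
  qed
qed (use assms in \<open>auto intro: smooth_products.mult\<close>)

section \<open>Smooth steps built from exp(-1/x)\<close>

text \<open>The polynomial factor makes the family closed under differentiation: p is replaced by
  X^2 (p - p').\<close>

definition flat :: "real poly \<Rightarrow> real \<Rightarrow> real" where
  "flat p x = (if x > 0 then poly p (1 / x) * exp (- (1 / x)) else 0)"

lemma poly_mult_exp_minus_tendsto_0:
  "((\<lambda>x. poly p x * exp (- x)) \<longlongrightarrow> 0) at_top" for p :: "real poly"
proof -
  have "((\<lambda>x. \<Sum>i\<le>degree p. coeff p i * (x ^ i / exp x)) \<longlongrightarrow> (\<Sum>i\<le>degree p. coeff p i * 0)) at_top"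
    by (intro tendsto_sum tendsto_mult tendsto_const tendsto_power_div_exp_0)
  then show ?thesis
    by (simp add: poly_altdef exp_minus divide_inverse sum_distrib_right mult.assoc)
qed

lemma flat_tendsto_0: "(flat p \<longlongrightarrow> 0) (at 0)"
proof (rule filterlim_split_at_real)
  show "(flat p \<longlongrightarrow> 0) (at_left 0)"
    by (rule tendsto_eventually) (auto simp: flat_def eventually_at_filter)
  have "((\<lambda>x. poly p (inverse x) * exp (- inverse x)) \<longlongrightarrow> 0) (at_right 0)"
    by (rule filterlim_compose[OF poly_mult_exp_minus_tendsto_0 filterlim_inverse_at_top_right])
  then show "(flat p \<longlongrightarrow> 0) (at_right 0)"
    by (rule tendsto_cong[THEN iffD1, rotated])
      (auto simp: flat_def eventually_at_filter inverse_eq_divide)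
qed

lemma flat_has_derivative:
  "(flat p has_field_derivative flat ([:0, 0, 1:] * (p - pderiv p)) x) (at x)"
proof -
  consider "x > 0" | "x < 0" | "x = 0" by linarith
  then show ?thesis
  proof cases
    case 1
    have "((\<lambda>x. poly p (1 / x) * exp (- (1 / x))) has_field_derivative
        flat ([:0, 0, 1:] * (p - pderiv p)) x) (at x)"
      using 1 by (auto intro!: derivative_eq_intros DERIV_chain'[where g = "poly p"] poly_DERIV
          simp: flat_def field_simps power2_eq_square)
    then show ?thesis
      using 1 by (elim has_field_derivative_transform_within_open[where S = "{0<..}"]) (auto simp: flat_def)
  next
    case 2
    have "((\<lambda>x. 0) has_field_derivative flat ([:0, 0, 1:] * (p - pderiv p)) x) (at x)"
      using 2 by (simp add: flat_def)
    then show ?thesis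
      using 2 by (elim has_field_derivative_transform_within_open[where S = "{..<0}"]) (auto simp: flat_def)
  next
    case 3
    \<comment> \<open>The difference quotient at 0 is again a flat function: dividing by h
      multiplies the polynomial in 1/h by X.\<close>
    have "((\<lambda>h. flat ([:0, 1:] * p) h) \<longlongrightarrow> 0) (at 0)"
      by (rule flat_tendsto_0)
    then have "((\<lambda>h. (flat p (0 + h) - flat p 0) / h) \<longlongrightarrow> 0) (at 0)"
      by (rule tendsto_cong[THEN iffD1, rotated])
        (auto simp: flat_def eventually_at_filter field_simps)
    then show ?thesis
      using 3 by (simp add: DERIV_def flat_def)
  qed
qed

lemma smooth_flat_affine: "smooth (\<lambda>x. flat p (c * x + d))"
proof (rule smooth_coinduct[of _ "{\<lambda>x. flat p (c * x + d) | p. True}"])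
  fix \<psi> assume "\<psi> \<in> {\<lambda>x. flat p (c * x + d) | p. True}"
  then obtain p where \<psi>: "\<psi> = (\<lambda>x. flat p (c * x + d))" by auto
  have *: "((\<lambda>x. flat p (c * x + d)) has_field_derivative
      flat ([:0, 0, 1:] * (p - pderiv p)) (c * t + d) * c) (at t)" for t
    by (rule DERIV_chain2[OF flat_has_derivative]) (auto intro!: derivative_eq_intros)
  have **: "flat q y * c = flat (smult c q) y" for q y
    by (simp add: flat_def)
  show "\<exists>\<psi>'\<in>{\<lambda>x. flat p (c * x + d) | p. True}. \<forall>t. (\<psi> has_field_derivative \<psi>' t) (at t)"
    using * unfolding \<psi> **
    by (intro bexI[of _ "\<lambda>t. flat (smult c ([:0, 0, 1:] * (p - pderiv p))) (c * t + d)"]) auto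
qed auto

text \<open>The step is the normalised primitive of a bump on [a, b]. Its derivative
  \<open>\<eta>\<close> is thus a probability density, which later plays an approximate delta at an
  endpoint.\<close>

lemma smooth_step_exists:
  fixes a b :: real
  assumes "a < b"
  obtains s \<eta> :: "real \<Rightarrow> real" where "smooth s" "\<And>t. (s has_field_derivative \<eta> t) (at t)" "continuous_on UNIV \<eta>"
    "\<And>t. t \<le> a \<Longrightarrow> s t = 0" "\<And>t. t \<ge> b \<Longrightarrow> s t = 1"
    "\<And>t. \<eta> t \<ge> 0" "\<And>t. t \<notin> {a..b} \<Longrightarrow> \<eta> t = 0"
proof -
  define \<zeta> where "\<zeta> x = flat 1 (1 * x + - a) * flat 1 (- 1 * x + b)" for x
  have sm: "smooth \<zeta>"
    unfolding \<zeta>_def by (intro smooth_mult smooth_flat_affine)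
  have cont: "continuous_on S \<zeta>" for S
    using sm by (rule smooth_continuous_on)
  have nonneg: "\<zeta> x \<ge> 0" for x
    by (simp add: \<zeta>_def flat_def)
  have zero: "\<zeta> x = 0" if "x \<le> a \<or> x \<ge> b" for x
    using that by (auto simp: \<zeta>_def flat_def)
  have pos: "\<zeta> x > 0" if "a < x" "x < b" for x
    using that by (auto simp: \<zeta>_def flat_def)
  \<comment> \<open>The lower limit lies strictly left of a, so each t >= a is interior to a range
    of integration and the derivative there is two-sided; for t < a the function is locally
    zero.\<close>
  define I where "I t = integral {a - 1..t} \<zeta>" for t
  have I_left: "I t = 0" if "t \<le> a" for t
    unfolding I_def using that zero by (intro integral_unique has_integral_is_0) auto
  have I_deriv: "(I has_field_derivative \<zeta> t) (at t)" for t
  proof (cases "t < a")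
    case True
    have "((\<lambda>_. 0) has_field_derivative \<zeta> t) (at t)"
      using zero True by simp
    then show ?thesis
      using True by (elim has_field_derivative_transform_within_open[where S = "{..<a}"]) (auto simp: I_left)
  next
    case False
    have "((\<lambda>t. integral {a - 1..t} \<zeta>) has_real_derivative \<zeta> t) (at t within {a - 1..t + 1})"
      by (rule integral_has_real_derivative) (use False cont in auto)
    moreover have "at t within {a - 1..t + 1} = at t"
      by (rule at_within_interior) (use False in auto)
    ultimately show ?thesis
      by (simp add: I_def[abs_def])
  qed
  have I_right: "I t = I b" if "t \<ge> b" for t
  proof -
    have "I t - I b = integral {b..t} \<zeta>"
      using Henstock_Kurzweil_Integration.integral_combine[where a = "a - 1" and c = b and b = t and f = \<zeta>]
        integrable_continuous_real[OF cont, of "a - 1" t] assms that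
      by (simp add: I_def)
    also have "\<dots> = integral {b..t} (\<lambda>_. 0)"
      by (rule integral_cong) (use zero in auto)
    finally show ?thesis by simp
  qed
  have "I b > 0"
  proof -
    have "I a < I b"
    proof (rule DERIV_pos_imp_increasing_open[OF assms])
      show "\<exists>y. (I has_real_derivative y) (at x) \<and> y > 0" if "a < x" "x < b" for x
        using I_deriv pos that by blast
      show "continuous_on {a..b} I"
        by (meson DERIV_isCont I_deriv continuous_at_imp_continuous_on)
    qed
    then show ?thesis by (simp add: I_left)
  qed
  show ?thesis
  proof
    show d: "((\<lambda>t. I t / I b) has_field_derivative \<zeta> t / I b) (at t)" for t
      by (intro DERIV_cdivide I_deriv)
    have "smooth (\<lambda>t. \<zeta> t / I b)"
    proof (rule smooth_coinduct[of _ "{\<lambda>t. u t / I b | u. smooth u}"])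
      fix \<psi> assume "\<psi> \<in> {\<lambda>t. u t / I b | u. smooth u}"
      then obtain u where "\<psi> = (\<lambda>t. u t / I b)" "smooth u" by auto
      then show "\<exists>\<psi>'\<in>{\<lambda>t. u t / I b | u. smooth u}. \<forall>t. (\<psi> has_field_derivative \<psi>' t) (at t)"
        by (intro bexI[of _ "\<lambda>t. deriv u t / I b"])
          (auto intro!: DERIV_cdivide smooth_has_derivative smooth_deriv)
    qed (use sm in auto)
    with d show "smooth (\<lambda>t. I t / I b)"
      by (rule smooth_antiderivative)
    show "continuous_on UNIV (\<lambda>t. \<zeta> t / I b)"
      using \<open>I b > 0\<close> by (intro continuous_intros cont) auto
    show "I t / I b = 0" if "t \<le> a" for t
      using I_left[OF that] by simp
    show "I t / I b = 1" if "t \<ge> b" for t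
      using I_right[OF that] \<open>I b > 0\<close> by simp
    show "\<zeta> t / I b \<ge> 0" for t
      using nonneg \<open>I b > 0\<close> by simp
    show "\<zeta> t / I b = 0" if "t \<notin> {a..b}" for t
      using zero that by auto
  qed
qed

lemma smooth_imp_test_function:
  assumes "smooth \<psi>" "0 < a" "\<And>t. t \<notin> {a..b} \<Longrightarrow> \<psi> t = 0"
  shows "test_function {0<..} \<psi>"
proof -
  have "{t. \<psi> t \<noteq> 0} \<subseteq> {a..b}"
    using assms(3) by blast
  then have "closure {t. \<psi> t \<noteq> 0} \<subseteq> {a..b}"
    by (simp add: closure_minimal)
  moreover have "compact (closure {t. \<psi> t \<noteq> 0})"
    using \<open>{t. \<psi> t \<noteq> 0} \<subseteq> {a..b}\<close> by (meson bounded_closed_interval bounded_subset compact_closure)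
  moreover have "{a..b} \<subseteq> {0<..}"
    using assms(2) by auto
  ultimately show ?thesis
    using assms(1) by (simp add: test_function_def smooth_def subset_trans)
qed

section \<open>The du Bois-Reymond lemma\<close>

text \<open>A mean with respect to a probability density stays as close to c as the averaged values;
  closeness is asked only where the density is nonzero.\<close>

lemma integral_mult_weight_close:
  fixes w \<eta> :: "real \<Rightarrow> real"
  assumes "a \<le> b" "continuous_on {a..b} w" "continuous_on {a..b} \<eta>"
    and "(\<eta> has_integral 1) {a..b}" "\<And>t. t \<in> {a..b} \<Longrightarrow> \<eta> t \<ge> 0"
    and "\<And>t. t \<in> {a..b} \<Longrightarrow> \<eta> t \<noteq> 0 \<Longrightarrow> \<bar>w t - c\<bar> \<le> \<delta>"
  shows "\<bar>integral {a..b} (\<lambda>t. w t * \<eta> t) - c\<bar> \<le> \<delta>"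
proof -
  have 1: "((\<lambda>t. w t * \<eta> t) has_integral integral {a..b} (\<lambda>t. w t * \<eta> t)) {a..b}"
    using assms(2,3) by (intro integrable_integral integrable_continuous_real continuous_intros)
  have 2: "((\<lambda>t. k * \<eta> t) has_integral k) {a..b}" for k
    using has_integral_mult_right[OF assms(4), of k] by simp
  have "w t * \<eta> t \<le> (c + \<delta>) * \<eta> t" "(c - \<delta>) * \<eta> t \<le> w t * \<eta> t" if "t \<in> {a..b}" for t
    using assms(5,6)[OF that] by (cases "\<eta> t = 0"; auto intro!: mult_right_mono)+
  then have "integral {a..b} (\<lambda>t. w t * \<eta> t) \<le> c + \<delta>" "c - \<delta> \<le> integral {a..b} (\<lambda>t. w t * \<eta> t)"
    using has_integral_le[OF 1 2] has_integral_le[OF 2 1] by blast+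
  then show ?thesis by linarith
qed

text \<open>
  The du Bois-Reymond lemma: testing against the difference of two smooth steps shows that
  \<open>g - \<integral>h\<close> takes the same value at any two points.
\<close>

lemma distributional_derivative_constant:
  fixes g h :: "real \<Rightarrow> real"
  assumes dist: "has_distributional_derivative_on g h {0<..}"
    and g: "continuous_on {0..} g" and h: "continuous_on {0..} h"
    and "0 < a" "a < b"
  shows "g b - integral {0..b} h = g a - integral {0..a} h"
proof -
  define H where "H t = integral {0..t} h" for t
  define w where "w t = g t - H t" for t
  have H_deriv: "(H has_real_derivative h t) (at t within {a..b})" if "t \<in> {a..b}" for t
  proof -
    have "(H has_real_derivative h t) (at t within {0..b})"
      unfolding H_def using \<open>0 < a\<close> that
      by (intro integral_has_real_derivative continuous_on_subset[OF h]) auto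
    then show ?thesis
      by (rule has_field_derivative_subset) (use \<open>0 < a\<close> in auto)
  qed
  have contH: "continuous_on {a..b} H"
    using H_deriv DERIV_continuous continuous_on_eq_continuous_within by blast
  have contg: "continuous_on {a..b} g" and conth: "continuous_on {a..b} h"
    using g h \<open>0 < a\<close> by (auto intro: continuous_on_subset)
  have contw: "continuous_on {a..b} w"
    unfolding w_def by (intro continuous_intros contg contH)
  have close: "\<bar>w b - w a\<bar> \<le> 2 * \<delta>" if "\<delta> > 0" for \<delta>
  proof -
    have "\<exists>\<epsilon>>0. \<forall>t\<in>{a..b}. dist t c < \<epsilon> \<longrightarrow> dist (w t) (w c) < \<delta>" if "c \<in> {a..b}" for c
      using contw that \<open>\<delta> > 0\<close> unfolding continuous_on_iff by blast
    from this[of a] this[of b] obtain \<epsilon>1 \<epsilon>2 where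
      \<epsilon>1: "\<epsilon>1 > 0" "\<And>t. t \<in> {a..b} \<Longrightarrow> dist t a < \<epsilon>1 \<Longrightarrow> dist (w t) (w a) < \<delta>" and
      \<epsilon>2: "\<epsilon>2 > 0" "\<And>t. t \<in> {a..b} \<Longrightarrow> dist t b < \<epsilon>2 \<Longrightarrow> dist (w t) (w b) < \<delta>"
      using \<open>a < b\<close> by auto
    \<comment> \<open>Halving keeps the closed interval [a, a + \<epsilon>] inside the open
      neighbourhood of a, and likewise at b. The bound b - a makes \<open>\<psi>\<close> vanish
      outside [a, b]; the two transition ranges may overlap.\<close>
    define \<epsilon> where "\<epsilon> = min (min \<epsilon>1 \<epsilon>2 / 2) (b - a)"
    have \<epsilon>: "\<epsilon> > 0" "\<epsilon> < \<epsilon>1" "\<epsilon> < \<epsilon>2" "\<epsilon> \<le> b - a"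
      using \<epsilon>1(1) \<epsilon>2(1) \<open>a < b\<close> by (auto simp: \<epsilon>_def min_def)
    obtain s1 \<eta>1 where s1: "smooth s1" "\<And>t. (s1 has_field_derivative \<eta>1 t) (at t)"
      "continuous_on UNIV \<eta>1" "\<And>t. t \<le> a \<Longrightarrow> s1 t = 0" "\<And>t. t \<ge> a + \<epsilon> \<Longrightarrow> s1 t = 1"
      "\<And>t. \<eta>1 t \<ge> 0" "\<And>t. t \<notin> {a..a + \<epsilon>} \<Longrightarrow> \<eta>1 t = 0"
      by (rule smooth_step_exists[of a "a + \<epsilon>"]) (use \<epsilon> in auto)
    obtain s2 \<eta>2 where s2: "smooth s2" "\<And>t. (s2 has_field_derivative \<eta>2 t) (at t)"
      "continuous_on UNIV \<eta>2" "\<And>t. t \<le> b - \<epsilon> \<Longrightarrow> s2 t = 0" "\<And>t. t \<ge> b \<Longrightarrow> s2 t = 1"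
      "\<And>t. \<eta>2 t \<ge> 0" "\<And>t. t \<notin> {b - \<epsilon>..b} \<Longrightarrow> \<eta>2 t = 0"
      by (rule smooth_step_exists[of "b - \<epsilon>" b]) (use \<epsilon> in auto)
    have cont\<eta>: "continuous_on {a..b} \<eta>1" "continuous_on {a..b} \<eta>2"
      using s1(3) s2(3) by (auto intro: continuous_on_subset)
    define \<psi> where "\<psi> t = s1 t - s2 t" for t
    have \<psi>_zero: "\<psi> t = 0" if "t \<notin> {a..b}" for t
      using that s1(4,5)[of t] s2(4,5)[of t] \<epsilon> by (cases "t < a") (auto simp: \<psi>_def)
    have \<psi>_deriv: "(\<psi> has_field_derivative (\<eta>1 t - \<eta>2 t)) (at t)" for t
      unfolding \<psi>_def by (intro DERIV_diff s1 s2)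
    then have deriv_\<psi>: "deriv \<psi> t = \<eta>1 t - \<eta>2 t" for t
      by (rule DERIV_imp_deriv)
    have "smooth \<psi>"
      unfolding \<psi>_def[abs_def] by (intro smooth_diff s1 s2)
    then have "test_function {0<..} \<psi>"
      using \<psi>_zero \<open>0 < a\<close> by (intro smooth_imp_test_function) auto
    then have test: "integral {0<..} (\<lambda>t. h t * \<psi> t) = - integral {0<..} (\<lambda>t. g t * deriv \<psi> t)"
      using dist unfolding has_distributional_derivative_on_def by blast
    have restrict: "integral {0<..} F = integral {a..b} F" if "\<And>t. t \<notin> {a..b} \<Longrightarrow> F t = 0"
      for F :: "real \<Rightarrow> real"
    proof -
      have "integral {0<..} F = integral {0<..} (\<lambda>t. if t \<in> {a..b} then F t else 0)"
        using that by (intro integral_cong) auto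
      also have "\<dots> = integral {a..b} F"
        using \<open>0 < a\<close> by (subst integral_restrict_Int) (simp add: Int_absorb2 subset_iff inf.absorb1)
      finally show ?thesis .
    qed
    have \<eta>_zero: "\<eta>1 t - \<eta>2 t = 0" if "t \<notin> {a..b}" for t
      using that s1(7)[of t] s2(7)[of t] \<epsilon> by auto
    have hg: "integral {a..b} (\<lambda>t. h t * \<psi> t) = - integral {a..b} (\<lambda>t. g t * (\<eta>1 t - \<eta>2 t))"
      using test unfolding deriv_\<psi>
      by (subst (asm) (1 2) restrict) (use \<psi>_zero \<eta>_zero in auto)
    have cont\<psi>: "continuous_on {a..b} \<psi>"
      using \<open>smooth \<psi>\<close> by (rule smooth_continuous_on)
    \<comment> \<open>Integration by parts for H \<psi>, whose boundary values are 0, moves h onto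
      its primitive H. Together with \<open>hg\<close> this leaves equal means of w = g - H under
      the two densities.\<close>
    have "((\<lambda>t. h t * \<psi> t + (H t * \<eta>1 t - H t * \<eta>2 t)) has_integral (H b * \<psi> b - H a * \<psi> a)) {a..b}"
    proof (rule fundamental_theorem_of_calculus)
      fix t assume "t \<in> {a..b}"
      then have "((\<lambda>t. H t * \<psi> t) has_real_derivative (h t * \<psi> t + (\<eta>1 t - \<eta>2 t) * H t))
          (at t within {a..b})"
        by (intro DERIV_mult H_deriv has_field_derivative_at_within[OF \<psi>_deriv])
      then show "((\<lambda>t. H t * \<psi> t) has_vector_derivative (h t * \<psi> t + (H t * \<eta>1 t - H t * \<eta>2 t)))
          (at t within {a..b})"
        by (simp add: algebra_simps has_real_derivative_iff_has_vector_derivative)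
    qed (use \<open>a < b\<close> in simp)
    moreover have "\<psi> a = 0" "\<psi> b = 0"
      using s1(4,5) s2(4,5) \<epsilon> by (auto simp: \<psi>_def)
    ultimately have "integral {a..b} (\<lambda>t. h t * \<psi> t + (H t * \<eta>1 t - H t * \<eta>2 t)) = 0"
      by (simp add: integral_unique)
    moreover have "(\<lambda>t. h t * \<psi> t) integrable_on {a..b}"
      by (intro integrable_continuous_real continuous_on_mult conth cont\<psi>)
    moreover have int: "(\<lambda>t. H t * \<eta>1 t) integrable_on {a..b}" "(\<lambda>t. H t * \<eta>2 t) integrable_on {a..b}"
      "(\<lambda>t. g t * \<eta>1 t) integrable_on {a..b}" "(\<lambda>t. g t * \<eta>2 t) integrable_on {a..b}"
      by (intro integrable_continuous_real continuous_on_mult contg contH cont\<eta>)+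
    ultimately have eq: "integral {a..b} (\<lambda>t. w t * \<eta>1 t) = integral {a..b} (\<lambda>t. w t * \<eta>2 t)"
      using hg by (simp add: w_def algebra_simps integral_add integral_diff integrable_diff integrable_add)
    have "(\<eta>1 has_integral s1 b - s1 a) {a..b}" "(\<eta>2 has_integral s2 b - s2 a) {a..b}"
      using \<open>a < b\<close> s1(2) s2(2)
      by (simp_all add: fundamental_theorem_of_calculus has_vector_derivative_at_within
          has_real_derivative_iff_has_vector_derivative)
    then have one: "(\<eta>1 has_integral 1) {a..b}" "(\<eta>2 has_integral 1) {a..b}"
      using s1(4,5) s2(4,5) \<epsilon> by auto
    have "\<bar>integral {a..b} (\<lambda>t. w t * \<eta>1 t) - w a\<bar> \<le> \<delta>"
    proof (rule integral_mult_weight_close)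
      show "\<bar>w t - w a\<bar> \<le> \<delta>" if "t \<in> {a..b}" "\<eta>1 t \<noteq> 0" for t
        using \<epsilon>1(2)[of t] that s1(7)[of t] \<epsilon> by (force simp: dist_real_def)
    qed (rule less_imp_le[OF \<open>a < b\<close>] contw cont\<eta> one s1(6))+
    moreover have "\<bar>integral {a..b} (\<lambda>t. w t * \<eta>2 t) - w b\<bar> \<le> \<delta>"
    proof (rule integral_mult_weight_close)
      show "\<bar>w t - w b\<bar> \<le> \<delta>" if "t \<in> {a..b}" "\<eta>2 t \<noteq> 0" for t
        using \<epsilon>2(2)[of t] that s2(7)[of t] \<epsilon> by (force simp: dist_real_def)
    qed (rule less_imp_le[OF \<open>a < b\<close>] contw cont\<eta> one s2(6))+
    ultimately show ?thesis
      using eq by linarith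
  qed
  have "\<bar>w b - w a\<bar> \<le> 0"
  proof (rule field_le_epsilon)
    show "\<bar>w b - w a\<bar> \<le> 0 + \<delta>" if "\<delta> > 0" for \<delta>
      using close[of "\<delta> / 2"] that by simp
  qed
  then show ?thesis
    by (simp add: w_def H_def)
qed

text \<open>Test functions live on the open half-line and see nothing at time 0; continuity at 0
  extends the identity to the initial value.\<close>

lemma integral_distributional_derivative:
  fixes g h :: "real \<Rightarrow> real"
  assumes dist: "has_distributional_derivative_on g h {0<..}"
    and g: "continuous_on {0..} g" and h: "continuous_on {0..} h"
    and "0 < T"
  shows "integral {0..T} h = g T - g 0"
proof -
  define w where "w t = g t - integral {0..t} h" for t
  have "continuous_on {0..T} g" "h integrable_on {0..T}"
    using continuous_on_subset[OF g, of "{0..T}"] continuous_on_subset[OF h, of "{0..T}"]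
    by (auto intro: integrable_continuous_real)
  then have contw: "continuous_on {0..T} w"
    unfolding w_def by (intro continuous_on_diff indefinite_integral_continuous_1)
  have w: "w t = w T" if "0 < t" "t \<le> T" for t
    using distributional_derivative_constant[OF dist g h, of t T] that by (cases "t = T") (auto simp: w_def)
  have "(w \<longlongrightarrow> w 0) (at_right 0)"
    using contw \<open>0 < T\<close> by (rule continuous_on_Icc_at_rightD)
  moreover have "(w \<longlongrightarrow> w T) (at_right 0)"
  proof (rule tendsto_eventually)
    have "eventually (\<lambda>t. t \<in> {0<..<T}) (at_right 0)"
      using \<open>0 < T\<close> by (rule eventually_at_right_real)
    then show "eventually (\<lambda>t. w t = w T) (at_right 0)"

      by (rule eventually_mono) (simp add: w[OF _ less_imp_le])
  qed
  ultimately have "w 0 = w T"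
    by (rule tendsto_unique[rotated]) simp
  then show ?thesis
    by (simp add: w_def)
qed

section \<open>Summation by parts on the lattice\<close>

definition lattice_box :: "int \<Rightarrow> int \<Rightarrow> (int ^ 'n) set" where
  "lattice_box l r = {\<alpha>. \<forall>j. l \<le> \<alpha> $ j \<and> \<alpha> $ j \<le> r}"

text \<open>Vectors in the box are the functions from coordinates to the interval, so this is
  distributivity. It factors the sums of product cutoffs and also counts the points of a
  box.\<close>

lemma sum_lattice_box_prod:
  fixes g :: "'n::finite \<Rightarrow> int \<Rightarrow> real"
  shows "(\<Sum>\<alpha>\<in>lattice_box l r. \<Prod>j\<in>UNIV. g j (\<alpha> $ j)) = (\<Prod>j\<in>UNIV. \<Sum>k\<in>{l..r}. g j k)"
proof -
  have "(\<Prod>j\<in>UNIV. \<Sum>k\<in>{l..r}. g j k) = (\<Sum>\<sigma>\<in>Pi\<^sub>E UNIV (\<lambda>_. {l..r}). \<Prod>j\<in>UNIV. g j (\<sigma> j))"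
    by (intro prod_sum_PiE) auto
  also have "\<dots> = (\<Sum>\<alpha>\<in>lattice_box l r. \<Prod>j\<in>UNIV. g j (\<alpha> $ j))"
    by (rule sum.reindex_bij_witness[of _ vec_nth vec_lambda]) (auto simp: lattice_box_def PiE_iff)
  finally show ?thesis by simp
qed

lemma finite_lattice_box [simp]: "finite (lattice_box l r :: (int ^ 'n::finite) set)"
proof -
  have "lattice_box l r \<subseteq> vec_lambda ` (Pi\<^sub>E UNIV (\<lambda>_::'n. {l..r}))"
  proof
    fix \<alpha> :: "int ^ 'n" assume "\<alpha> \<in> lattice_box l r"
    then have "vec_nth \<alpha> \<in> Pi\<^sub>E UNIV (\<lambda>_. {l..r})"
      by (auto simp: lattice_box_def)
    moreover have "\<alpha> = vec_lambda (vec_nth \<alpha>)" by simp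
    ultimately show "\<alpha> \<in> vec_lambda ` (Pi\<^sub>E UNIV (\<lambda>_. {l..r}))" by blast
  qed
  then show ?thesis
    by (rule finite_subset) (auto intro!: finite_imageI finite_PiE)
qed

lemma lattice_box_mono: "l' \<le> l \<Longrightarrow> r \<le> r' \<Longrightarrow> lattice_box l r \<subseteq> lattice_box l' r'"
  unfolding lattice_box_def by (blast intro: order_trans)

lemma mem_lattice_box_abs_iff: "\<alpha> \<in> lattice_box (- K) K \<longleftrightarrow> (\<forall>j. \<bar>\<alpha> $ j\<bar> \<le> K)"
  by (auto simp: lattice_box_def abs_le_iff neg_le_iff_le minus_le_iff)

lemma finite_subset_lattice_box:
  fixes A :: "(int ^ 'n::finite) set"
  assumes "finite A"
  obtains K where "K \<ge> K0" "A \<subseteq> lattice_box (- K) K"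
proof
  define S where "S = insert 0 ((\<lambda>(\<alpha>, j). \<bar>\<alpha> $ j\<bar>) ` (A \<times> UNIV))"
  have S: "finite S" using assms by (simp add: S_def)
  show "max K0 (Max S) \<ge> K0" by simp
  have "\<bar>\<alpha> $ j\<bar> \<le> max K0 (Max S)" if "\<alpha> \<in> A" for \<alpha> j
  proof -
    have "\<bar>\<alpha> $ j\<bar> \<in> S" using that by (force simp: S_def)
    then show ?thesis using S Max_ge by (metis max.coboundedI2)
  qed
  then show "A \<subseteq> lattice_box (- max K0 (Max S)) (max K0 (Max S))"
    by (auto simp: mem_lattice_box_abs_iff)
qed

text \<open>B contains the support of \<kappa> and its backward shifts, so no boundary term arises.
  Backward differences in \<open>lattice_div\<close> become forward differences of \<kappa>.\<close>

lemma sum_mult_lattice_div: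
  fixes \<kappa> :: "int ^ 'n::finite \<Rightarrow> real"
  assumes "finite B" and "\<And>\<alpha>. \<kappa> \<alpha> \<noteq> 0 \<Longrightarrow> \<alpha> \<in> B" "\<And>\<alpha> j. \<kappa> \<alpha> \<noteq> 0 \<Longrightarrow> \<alpha> - axis j 1 \<in> B"
  shows "(\<Sum>\<alpha>\<in>B. \<kappa> \<alpha> * lattice_div v \<alpha>) =
    (\<Sum>\<alpha>\<in>B. \<Sum>j\<in>UNIV. (\<kappa> \<alpha> - \<kappa> (\<alpha> + axis j 1)) * v \<alpha> $ j)"
proof -
  have shift: "(\<Sum>\<alpha>\<in>B. \<kappa> \<alpha> * v (\<alpha> - axis j 1) $ j) = (\<Sum>\<alpha>\<in>B. \<kappa> (\<alpha> + axis j 1) * v \<alpha> $ j)" for j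
  proof -
    have "(\<Sum>\<alpha>\<in>B. \<kappa> \<alpha> * v (\<alpha> - axis j 1) $ j) = (\<Sum>\<alpha> | \<kappa> \<alpha> \<noteq> 0. \<kappa> \<alpha> * v (\<alpha> - axis j 1) $ j)"
      using assms by (intro sum.mono_neutral_right) auto
    also have "\<dots> = (\<Sum>\<alpha> | \<kappa> (\<alpha> + axis j 1) \<noteq> 0. \<kappa> (\<alpha> + axis j 1) * v \<alpha> $ j)"
      by (rule sum.reindex_bij_witness[of _ "\<lambda>\<alpha>. \<alpha> + axis j 1" "\<lambda>\<alpha>. \<alpha> - axis j 1"]) auto
    also have "\<dots> = (\<Sum>\<alpha>\<in>B. \<kappa> (\<alpha> + axis j 1) * v \<alpha> $ j)"
      using assms(1) assms(3)[of "_ + axis j 1" j] by (intro sum.mono_neutral_left) auto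
    finally show ?thesis .
  qed
  have "(\<Sum>\<alpha>\<in>B. \<kappa> \<alpha> * lattice_div v \<alpha>) =
      (\<Sum>\<alpha>\<in>B. \<Sum>j\<in>UNIV. \<kappa> \<alpha> * v \<alpha> $ j - \<kappa> \<alpha> * v (\<alpha> - axis j 1) $ j)"
    by (simp add: lattice_div_def sum_distrib_left right_diff_distrib)
  also have "\<dots> = (\<Sum>j\<in>UNIV. (\<Sum>\<alpha>\<in>B. \<kappa> \<alpha> * v \<alpha> $ j) - (\<Sum>\<alpha>\<in>B. \<kappa> \<alpha> * v (\<alpha> - axis j 1) $ j))"
    by (subst sum.swap) (simp add: sum_subtractf)
  also have "\<dots> = (\<Sum>j\<in>UNIV. \<Sum>\<alpha>\<in>B. (\<kappa> \<alpha> - \<kappa> (\<alpha> + axis j 1)) * v \<alpha> $ j)"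
    by (simp add: shift sum_subtractf left_diff_distrib)
  also have "\<dots> = (\<Sum>\<alpha>\<in>B. \<Sum>j\<in>UNIV. (\<kappa> \<alpha> - \<kappa> (\<alpha> + axis j 1)) * v \<alpha> $ j)"
    by (rule sum.swap)
  finally show ?thesis .
qed

text \<open>Adding \<open>axis j 1\<close> leaves the cube exactly from its points with
  \<open>\<alpha> $ j = R\<close>, and enters it exactly from points whose only offending coordinate
  is \<open>\<alpha> $ j = - R\<close>. So \<open>cube_normal\<close> is minus the forward gradient
  of the indicator of the cube.\<close>

lemma cube_normal_component:
  fixes \<alpha> :: "int ^ 'n::finite"
  assumes "R \<ge> 1"
  shows "cube_normal R \<alpha> $ j = of_bool (\<alpha> \<in> lattice_box (- R + 1) R) -
    of_bool (\<alpha> + axis j 1 \<in> lattice_box (- R + 1) R)"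
proof -
  let ?C = "lattice_box (- R + 1) R :: (int ^ 'n) set"
  have shift: "(\<alpha> + axis j 1) $ i = \<alpha> $ i + of_bool (i = j)" for i
    by (auto simp: axis_def)
  consider
    (pos) "(\<exists>k. \<alpha> $ k = R) \<and> (\<forall>j. \<alpha> $ j \<noteq> R \<longrightarrow> - R + 1 \<le> \<alpha> $ j \<and> \<alpha> $ j \<le> R - 1)"
  | (neg) "\<not> ((\<exists>k. \<alpha> $ k = R) \<and> (\<forall>j. \<alpha> $ j \<noteq> R \<longrightarrow> - R + 1 \<le> \<alpha> $ j \<and> \<alpha> $ j \<le> R - 1))"
      "\<exists>k. \<alpha> $ k = - R \<and> (\<forall>j. j \<noteq> k \<longrightarrow> - R + 1 \<le> \<alpha> $ j \<and> \<alpha> $ j \<le> R)"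
  | (zero) "\<not> ((\<exists>k. \<alpha> $ k = R) \<and> (\<forall>j. \<alpha> $ j \<noteq> R \<longrightarrow> - R + 1 \<le> \<alpha> $ j \<and> \<alpha> $ j \<le> R - 1))"
      "\<not> (\<exists>k. \<alpha> $ k = - R \<and> (\<forall>j. j \<noteq> k \<longrightarrow> - R + 1 \<le> \<alpha> $ j \<and> \<alpha> $ j \<le> R))"
    by blast
  then show ?thesis
  proof cases
    case pos
    then have "cube_normal R \<alpha> $ j = (\<Sum>k | \<alpha> $ k = R. axis k 1 $ j)"
      unfolding cube_normal_def by simp
    also have "\<dots> = of_bool (\<alpha> $ j = R)"
      by (simp add: axis_def)
    finally have n: "cube_normal R \<alpha> $ j = of_bool (\<alpha> $ j = R)" .
    have range: "- R + 1 \<le> \<alpha> $ i \<and> \<alpha> $ i \<le> R" for i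
      using pos \<open>R \<ge> 1\<close> by (cases "\<alpha> $ i = R") force+
    then have "\<alpha> \<in> ?C"
      by (simp add: lattice_box_def)
    moreover have "\<alpha> + axis j 1 \<in> ?C \<longleftrightarrow> \<alpha> $ j \<noteq> R"
      unfolding lattice_box_def mem_Collect_eq shift using range
      by (smt (verit) of_bool_eq)
    ultimately show ?thesis
      using n by simp
  next
    case neg
    then obtain k where k: "\<alpha> $ k = - R" "\<And>i. i \<noteq> k \<Longrightarrow> - R + 1 \<le> \<alpha> $ i \<and> \<alpha> $ i \<le> R"
      by blast
    have "(THE k. \<alpha> $ k = - R) = k"
      by (rule the_equality) (use k in force)+
    then have n: "cube_normal R \<alpha> $ j = - of_bool (j = k)"
      using neg unfolding cube_normal_def by (simp add: axis_def)
    have "\<alpha> \<notin> ?C"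
      using k(1) by (auto simp: lattice_box_def intro!: exI[of _ k])
    moreover have "\<alpha> + axis j 1 \<in> ?C \<longleftrightarrow> j = k"
      unfolding lattice_box_def mem_Collect_eq shift using k \<open>R \<ge> 1\<close>
      by (smt (verit) of_bool_eq)
    ultimately show ?thesis
      using n by simp
  next
    case zero
    then have "cube_normal R \<alpha> = 0"
      unfolding cube_normal_def by (simp only: if_False)
    moreover have "\<alpha> \<in> ?C \<longleftrightarrow> \<alpha> + axis j 1 \<in> ?C"
    proof
      assume C: "\<alpha> \<in> ?C"
      have "\<alpha> $ i \<noteq> R" for i
      proof
        assume "\<alpha> $ i = R"
        moreover have "- R + 1 \<le> \<alpha> $ j \<and> \<alpha> $ j \<le> R - 1" if "\<alpha> $ j \<noteq> R" for j
          using C that unfolding lattice_box_def mem_Collect_eq by (smt (verit))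
        ultimately show False
          using zero(1) by blast
      qed
      then show "\<alpha> + axis j 1 \<in> ?C"
        using C unfolding lattice_box_def mem_Collect_eq shift by (smt (verit) of_bool_eq)
    next
      assume C: "\<alpha> + axis j 1 \<in> ?C"
      then have *: "- R + 1 \<le> \<alpha> $ i + of_bool (i = j) \<and> \<alpha> $ i + of_bool (i = j) \<le> R" for i
        unfolding lattice_box_def mem_Collect_eq shift by blast
      then have "- R + 1 \<le> \<alpha> $ i \<and> \<alpha> $ i \<le> R" if "i \<noteq> j" for i
        using that *[of i] by simp
      moreover from this have "\<alpha> $ j \<noteq> - R"
        using zero(2) by blast
      ultimately show "\<alpha> \<in> ?C"
        using *[of j] unfolding lattice_box_def mem_Collect_eq by (smt (verit) of_bool_eq)
    qed
    ultimately show ?thesis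
      by simp
  qed
qed

text \<open>The discrete divergence theorem. It is stated over any large finite B so that it can be
  combined with a cutoff summed over the same set.\<close>

lemma sum_cube_boundary_normal:
  fixes v :: "int ^ 'n::finite \<Rightarrow> real ^ 'n"
  assumes "R \<ge> 1" "finite B" "lattice_box (- R) R \<subseteq> B"
  shows "(\<Sum>\<alpha>\<in>cube_boundary R. v \<alpha> \<bullet> cube_normal R \<alpha>) =
    (\<Sum>\<alpha>\<in>B. of_bool (\<alpha> \<in> lattice_box (- R + 1) R) * lattice_div v \<alpha>)"
proof -
  have sub: "cube_boundary R \<subseteq> B"
    using assms(3) by (auto simp: cube_boundary_def mem_lattice_box_abs_iff subset_iff)
  have zero: "cube_normal R \<alpha> = 0" if "\<alpha> \<notin> cube_boundary R" for \<alpha> :: "int ^ 'n"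
  proof -
    have "\<not> ((\<exists>k. \<alpha> $ k = R) \<and> (\<forall>j. \<alpha> $ j \<noteq> R \<longrightarrow> - R + 1 \<le> \<alpha> $ j \<and> \<alpha> $ j \<le> R - 1))"
    proof
      assume *: "(\<exists>k. \<alpha> $ k = R) \<and> (\<forall>j. \<alpha> $ j \<noteq> R \<longrightarrow> - R + 1 \<le> \<alpha> $ j \<and> \<alpha> $ j \<le> R - 1)"
      have "\<bar>\<alpha> $ j\<bar> \<le> R" for j
        using * \<open>R \<ge> 1\<close> by (cases "\<alpha> $ j = R") (force simp: abs_le_iff)+
      moreover obtain k where "\<alpha> $ k = R" using * by blast
      then have "\<bar>\<alpha> $ k\<bar> = R" using \<open>R \<ge> 1\<close> by simp
      ultimately show False
        using that by (auto simp: cube_boundary_def)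
    qed
    moreover have "\<not> (\<exists>k. \<alpha> $ k = - R \<and> (\<forall>j. j \<noteq> k \<longrightarrow> - R + 1 \<le> \<alpha> $ j \<and> \<alpha> $ j \<le> R))"
    proof
      assume "\<exists>k. \<alpha> $ k = - R \<and> (\<forall>j. j \<noteq> k \<longrightarrow> - R + 1 \<le> \<alpha> $ j \<and> \<alpha> $ j \<le> R)"
      then obtain k where k: "\<alpha> $ k = - R" "\<And>j. j \<noteq> k \<Longrightarrow> - R + 1 \<le> \<alpha> $ j \<and> \<alpha> $ j \<le> R"
        by blast
      have "\<bar>\<alpha> $ j\<bar> \<le> R" for j
        using k(1) k(2)[of j] \<open>R \<ge> 1\<close> by (cases "j = k") (auto simp: abs_le_iff)
      moreover have "\<bar>\<alpha> $ k\<bar> = R" using k \<open>R \<ge> 1\<close> by simp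
      ultimately show False
        using that by (auto simp: cube_boundary_def)
    qed
    ultimately show ?thesis
      unfolding cube_normal_def by (simp only: if_False)
  qed
  have "(\<Sum>\<alpha>\<in>cube_boundary R. v \<alpha> \<bullet> cube_normal R \<alpha>) = (\<Sum>\<alpha>\<in>B. v \<alpha> \<bullet> cube_normal R \<alpha>)"
    using assms(2) sub by (intro sum.mono_neutral_left) (auto simp: zero)
  also have "\<dots> = (\<Sum>\<alpha>\<in>B. \<Sum>j\<in>UNIV. (of_bool (\<alpha> \<in> lattice_box (- R + 1) R) -
      of_bool (\<alpha> + axis j 1 \<in> lattice_box (- R + 1) R)) * v \<alpha> $ j)"
    by (simp add: inner_vec_def cube_normal_component[OF \<open>R \<ge> 1\<close>] mult.commute)
  also have "\<dots> = (\<Sum>\<alpha>\<in>B. of_bool (\<alpha> \<in> lattice_box (- R + 1) R) * lattice_div v \<alpha>)"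
  proof (rule sum_mult_lattice_div[symmetric])
    fix \<alpha> :: "int ^ 'n" and j
    assume "of_bool (\<alpha> \<in> lattice_box (- R + 1) R) \<noteq> (0::real)"
    then have *: "\<alpha> \<in> lattice_box (- R + 1) R" by simp
    then show "\<alpha> \<in> B"
      using assms(3) lattice_box_mono[of "- R" "- R + 1" R R] by auto
    have "\<alpha> - axis j 1 \<in> lattice_box (- R) R"
      using * by (auto simp: lattice_box_def axis_def intro: order_trans[OF _ add_increasing2])
        (smt (verit))+
    then show "\<alpha> - axis j 1 \<in> B"
      using assms(3) by auto
  qed (use assms in auto)
  finally show ?thesis .
qed

section \<open>Absorbing the gradient term into the dissipation\<close>

text \<open>Expand (2 c y - \<beta> x)^2 >= 0. The weight c/\<beta> is chosen so that, summed over
  the components y of a flux v with \<open>|v|\<^sup>2 \<le> \<beta> \<delta>\<close>, the first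
  term is at most c \<delta>.\<close>

lemma young_scaled:
  fixes x y c \<beta> :: real
  assumes "c > 0" "\<beta> > 0"
  shows "x * y \<le> c / \<beta> * y\<^sup>2 + \<beta> / 4 * (x\<^sup>2 / c)"
proof -
  have "0 \<le> (2 * c * y - \<beta> * x)\<^sup>2 / (4 * c * \<beta>)"
    using assms by simp
  also have "\<dots> = c / \<beta> * y\<^sup>2 + \<beta> / 4 * (x\<^sup>2 / c) - x * y"
    using assms by (simp add: field_simps power2_eq_square)
  finally show ?thesis by simp
qed

lemma gradient_flux_bound:
  fixes v :: "real ^ 'n"
  assumes "(norm v)\<^sup>2 \<le> \<beta> * \<delta>" "\<beta> \<ge> 0" "\<delta> \<ge> 0" "c > 0"
  shows "(\<Sum>j\<in>UNIV. g j * v $ j) \<le> c * \<delta> + \<beta> / 4 * (\<Sum>j\<in>UNIV. (g j)\<^sup>2 / c)"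
proof (cases "\<beta> = 0")
  case True
  then have "v = 0" using assms(1) by simp
  then show ?thesis using True assms by simp
next
  case False
  then have "\<beta> > 0" using assms by simp
  have v: "(norm v)\<^sup>2 = (\<Sum>j\<in>UNIV. (v $ j)\<^sup>2)"
    by (simp add: norm_vec_def L2_set_def sum_nonneg)
  have "(\<Sum>j\<in>UNIV. g j * v $ j) \<le> (\<Sum>j\<in>UNIV. c / \<beta> * (v $ j)\<^sup>2 + \<beta> / 4 * ((g j)\<^sup>2 / c))"
    by (intro sum_mono young_scaled) (use \<open>\<beta> > 0\<close> assms in auto)
  also have "\<dots> = c / \<beta> * (norm v)\<^sup>2 + \<beta> / 4 * (\<Sum>j\<in>UNIV. (g j)\<^sup>2 / c)"
    by (simp only: v sum.distrib sum_distrib_left)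
  also have "c / \<beta> * (norm v)\<^sup>2 \<le> c / \<beta> * (\<beta> * \<delta>)"
    using assms \<open>\<beta> > 0\<close> by (intro mult_left_mono) auto
  also have "\<dots> = c * \<delta>" using \<open>\<beta> > 0\<close> by simp
  finally show ?thesis by simp
qed

lemma sum_shift_le:
  fixes h :: "'a::ab_group_add \<Rightarrow> real"
  assumes "finite A" "finite B" "\<And>\<alpha>. h \<alpha> \<ge> 0" "\<And>\<alpha>. \<alpha> \<in> A \<Longrightarrow> h (\<alpha> + \<epsilon>) \<noteq> 0 \<Longrightarrow> \<alpha> + \<epsilon> \<in> B"
  shows "(\<Sum>\<alpha>\<in>A. h (\<alpha> + \<epsilon>)) \<le> sum h B"
proof -
  have "(\<Sum>\<alpha>\<in>A. h (\<alpha> + \<epsilon>)) = sum h ((\<lambda>\<alpha>. \<alpha> + \<epsilon>) ` A)"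
    by (subst sum.reindex) (auto simp: inj_on_def)
  also have "\<dots> = sum h {\<alpha> \<in> (\<lambda>\<alpha>. \<alpha> + \<epsilon>) ` A. h \<alpha> \<noteq> 0}"
    using assms(1) by (intro sum.mono_neutral_right) auto
  also have "\<dots> \<le> sum h B"
    using assms by (intro sum_mono2) auto
  finally show ?thesis .
qed

text \<open>The denominator is taken at \<alpha>, the base point of the difference, because the flux
  at \<alpha> is absorbed by the dissipation at the same \<alpha>.\<close>

definition cutoff_energy :: "(int ^ 'n::finite \<Rightarrow> real) \<Rightarrow> int ^ 'n \<Rightarrow> real" where
  "cutoff_energy \<theta> \<alpha> = (\<Sum>j\<in>UNIV. (\<theta> (\<alpha> + axis j 1) - \<theta> \<alpha>)\<^sup>2 / \<theta> \<alpha>)"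

lemma cutoff_energy_nonneg: "(\<And>\<alpha>. \<theta> \<alpha> > 0) \<Longrightarrow> cutoff_energy \<theta> \<alpha> \<ge> 0"
  unfolding cutoff_energy_def by (intro sum_nonneg) (simp add: less_imp_le)

text \<open>The indicator of the cube is the truncated cutoff minus \<kappa>. The first part gives
  gradient terms, which Young's inequality controls between the cube and the box; the second is
  regrouped with the dissipation into the right-hand side of the energy balance. Near the edge of
  the box the gradient of the truncated cutoff is not small compared with \<theta>, and only the
  bound c on the flux is used.\<close>

lemma cube_flux_le:
  fixes v :: "int ^ 'n::finite \<Rightarrow> real ^ 'n" and \<theta> \<delta> :: "int ^ 'n \<Rightarrow> real" and c :: real
  assumes "R \<ge> 1" "K \<ge> R + 3" and \<beta>: "\<beta> \<ge> 0"
    and v: "\<And>\<alpha>. (norm (v \<alpha>))\<^sup>2 \<le> \<beta> * \<delta> \<alpha>" "\<And>\<alpha>. norm (v \<alpha>) \<le> c" and \<delta>: "\<And>\<alpha>. \<delta> \<alpha> \<ge> 0"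
    and \<theta>: "\<And>\<alpha>. \<theta> \<alpha> > 0" "\<And>\<alpha>. \<alpha> \<in> lattice_box (- R + 1) (R + 1) \<Longrightarrow> \<theta> \<alpha> = 1"
    and \<kappa>: "\<And>\<alpha>. \<kappa> \<alpha> = of_bool (\<alpha> \<in> lattice_box (- K) K) * \<theta> \<alpha> - of_bool (\<alpha> \<in> lattice_box (- R + 1) R)"
  shows "(\<Sum>\<alpha>\<in>cube_boundary R. v \<alpha> \<bullet> cube_normal R \<alpha>) \<le>
    \<beta> / 4 * sum (cutoff_energy \<theta>) (lattice_box (- (K - 1)) (K - 1))
    + 2 * real CARD('n) * c * (sum \<theta> (lattice_box (- K) K) - sum \<theta> (lattice_box (- (K - 2)) (K - 2)))
    - (\<Sum>\<alpha>\<in>lattice_box (- (K + 1)) (K + 1). \<kappa> \<alpha> * (- \<delta> \<alpha> + lattice_div v \<alpha>))"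
proof -
  define B where "B r = (lattice_box (- r) r :: (int ^ 'n) set)" for r
  let ?C = "lattice_box (- R + 1) R :: (int ^ 'n) set"
  define \<theta>K where "\<theta>K \<alpha> = of_bool (\<alpha> \<in> B K) * \<theta> \<alpha>" for \<alpha>
  have B_finite: "finite (B r)" for r by (simp add: B_def)
  have B_mono: "B r \<subseteq> B r'" if "r \<le> r'" for r r'
    unfolding B_def using that by (intro lattice_box_mono) auto
  have shift: "(\<alpha> + axis j 1) $ i = \<alpha> $ i + of_bool (i = j)" for \<alpha> :: "int ^ 'n" and i j
    by (auto simp: axis_def)
  have B_plus: "\<alpha> + axis j 1 \<in> B (r + 1)" if "\<alpha> \<in> B r" for \<alpha> j r
    using that unfolding B_def lattice_box_def mem_Collect_eq shift by (smt (verit) of_bool_eq)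
  have B_minus: "\<alpha> \<in> B (r + 1)" if "\<alpha> + axis j 1 \<in> B r" for \<alpha> j r
    using that unfolding B_def lattice_box_def mem_Collect_eq shift by (smt (verit) of_bool_eq)
  have B_minus': "\<alpha> - axis j 1 \<in> B (r + 1)" if "\<alpha> \<in> B r" for \<alpha> j r
    using B_minus[of "\<alpha> - axis j 1" j r] that by simp
  have C_B: "?C \<subseteq> B R"
    unfolding B_def by (rule lattice_box_mono) auto
  have C_one: "\<theta> \<alpha> = 1" "\<theta> (\<alpha> + axis j 1) = 1" if "\<alpha> \<in> ?C" for \<alpha> j
  proof -
    have "\<alpha> \<in> lattice_box (- R + 1) (R + 1)"
      using that lattice_box_mono[of "- R + 1" "- R + 1" R "R + 1"] by auto
    moreover have "\<alpha> + axis j 1 \<in> lattice_box (- R + 1) (R + 1)"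
      using that unfolding lattice_box_def mem_Collect_eq shift by (smt (verit) of_bool_eq)
    ultimately show "\<theta> \<alpha> = 1" "\<theta> (\<alpha> + axis j 1) = 1" using \<theta>(2) by auto
  qed
  have \<theta>K_nonneg: "\<theta>K \<alpha> \<ge> 0" for \<alpha>
    using \<theta>(1)[of \<alpha>] by (simp add: \<theta>K_def)
  have \<kappa>_nonneg: "\<kappa> \<alpha> \<ge> 0" for \<alpha>
    using \<theta>(1)[of \<alpha>] C_one[of \<alpha>] C_B B_mono[of R K] \<open>K \<ge> R + 3\<close>
    by (auto simp: \<kappa> B_def)
  have c: "c \<ge> 0"
    using v(2) norm_ge_zero order_trans by blast
  have flux: "(\<Sum>\<alpha>\<in>cube_boundary R. v \<alpha> \<bullet> cube_normal R \<alpha>) =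
      (\<Sum>\<alpha>\<in>B (K + 1). \<Sum>j\<in>UNIV. (\<theta>K \<alpha> - \<theta>K (\<alpha> + axis j 1)) * v \<alpha> $ j) -
      (\<Sum>\<alpha>\<in>B (K + 1). \<kappa> \<alpha> * lattice_div v \<alpha>)"
  proof -
    have "(\<Sum>\<alpha>\<in>cube_boundary R. v \<alpha> \<bullet> cube_normal R \<alpha>) =
        (\<Sum>\<alpha>\<in>B (K + 1). of_bool (\<alpha> \<in> ?C) * lattice_div v \<alpha>)"
      using B_mono[of R "K + 1"] \<open>K \<ge> R + 3\<close> B_finite
      by (intro sum_cube_boundary_normal \<open>R \<ge> 1\<close>) (auto simp: B_def)
    also have "\<dots> = (\<Sum>\<alpha>\<in>B (K + 1). \<theta>K \<alpha> * lattice_div v \<alpha>) - (\<Sum>\<alpha>\<in>B (K + 1). \<kappa> \<alpha> * lattice_div v \<alpha>)"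
      unfolding sum_subtractf[symmetric] by (intro sum.cong) (auto simp: \<kappa> \<theta>K_def B_def algebra_simps)
    also have "(\<Sum>\<alpha>\<in>B (K + 1). \<theta>K \<alpha> * lattice_div v \<alpha>) =
        (\<Sum>\<alpha>\<in>B (K + 1). \<Sum>j\<in>UNIV. (\<theta>K \<alpha> - \<theta>K (\<alpha> + axis j 1)) * v \<alpha> $ j)"
      using B_mono[of K "K + 1"] B_minus'
      by (intro sum_mult_lattice_div B_finite) (auto simp: \<theta>K_def)
    finally show ?thesis .
  qed
  \<comment> \<open>The truncation error: outside \<open>B (K - 1)\<close> a forward neighbour may
    lie beyond the truncation, so each difference is bounded by the sum of both values.\<close>
  define bd where "bd \<alpha> = of_bool (\<alpha> \<notin> B (K - 1)) * (c * (\<Sum>j\<in>UNIV. \<theta>K \<alpha> + \<theta>K (\<alpha> + axis j 1)))" for \<alpha>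
  have pointwise: "(\<Sum>j\<in>UNIV. (\<theta>K \<alpha> - \<theta>K (\<alpha> + axis j 1)) * v \<alpha> $ j) \<le>
      \<kappa> \<alpha> * \<delta> \<alpha> + \<beta> / 4 * (of_bool (\<alpha> \<in> B (K - 1)) * cutoff_energy \<theta> \<alpha>) + bd \<alpha>" for \<alpha>
  proof -
    have en: "\<beta> / 4 * (of_bool (\<alpha> \<in> B (K - 1)) * cutoff_energy \<theta> \<alpha>) \<ge> 0"
      using \<beta> cutoff_energy_nonneg[of \<theta> \<alpha>] \<theta>(1) by simp
    have bd: "bd \<alpha> \<ge> 0"
      unfolding bd_def using c \<theta>K_nonneg by (intro mult_nonneg_nonneg sum_nonneg add_nonneg_nonneg) auto
    have \<kappa>\<delta>: "\<kappa> \<alpha> * \<delta> \<alpha> \<ge> 0"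
      using \<kappa>_nonneg \<delta> by simp
    consider "\<alpha> \<in> ?C" | "\<alpha> \<notin> ?C" "\<alpha> \<in> B (K - 1)" | "\<alpha> \<notin> B (K - 1)" by blast
    then show ?thesis
    proof cases
      \<comment> \<open>On the cube \<kappa> is 0, so no weighted dissipation is available to absorb
        a gradient. This is why \<theta> must also be 1 at the forward neighbours.\<close>
      case 1
      then have "\<alpha> \<in> B R" using C_B by blast
      then have "\<alpha> \<in> B K" "\<alpha> + axis j 1 \<in> B K" for j
        using B_plus[of \<alpha> R j] B_mono[of R K] B_mono[of "R + 1" K] \<open>K \<ge> R + 3\<close> by auto
      then have "\<theta>K \<alpha> - \<theta>K (\<alpha> + axis j 1) = 0" for j
        using C_one[OF 1] by (simp add: \<theta>K_def)
      then show ?thesis using en bd \<kappa>\<delta> by simp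
    next
      case 2
      then have in_B: "\<alpha> \<in> B K" "\<alpha> + axis j 1 \<in> B K" for j
        using B_plus[of \<alpha> "K - 1" j] B_mono[of "K - 1" K] by auto
      then have "\<kappa> \<alpha> = \<theta> \<alpha>" using 2 by (simp add: \<kappa> B_def)
      have "(\<Sum>j\<in>UNIV. (\<theta>K \<alpha> - \<theta>K (\<alpha> + axis j 1)) * v \<alpha> $ j) \<le>
          \<theta> \<alpha> * \<delta> \<alpha> + \<beta> / 4 * (\<Sum>j\<in>UNIV. (\<theta>K \<alpha> - \<theta>K (\<alpha> + axis j 1))\<^sup>2 / \<theta> \<alpha>)"
        by (intro gradient_flux_bound v \<beta> \<delta> \<theta>)
      also have "(\<Sum>j\<in>UNIV. (\<theta>K \<alpha> - \<theta>K (\<alpha> + axis j 1))\<^sup>2 / \<theta> \<alpha>) = cutoff_energy \<theta> \<alpha>"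
        using in_B by (simp add: cutoff_energy_def \<theta>K_def power2_commute)
      finally show ?thesis using 2 bd \<open>\<kappa> \<alpha> = \<theta> \<alpha>\<close> by simp
    next
      case 3
      have "(\<theta>K \<alpha> - \<theta>K (\<alpha> + axis j 1)) * v \<alpha> $ j \<le> (\<theta>K \<alpha> + \<theta>K (\<alpha> + axis j 1)) * c" for j
      proof -
        have "\<bar>\<theta>K \<alpha> - \<theta>K (\<alpha> + axis j 1)\<bar> \<le> \<theta>K \<alpha> + \<theta>K (\<alpha> + axis j 1)"
          using \<theta>K_nonneg[of \<alpha>] \<theta>K_nonneg[of "\<alpha> + axis j 1"] by linarith
        moreover have "\<bar>v \<alpha> $ j\<bar> \<le> c"
          using component_le_norm_cart[of "v \<alpha>" j] v(2)[of \<alpha>] by linarith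
        ultimately have "\<bar>(\<theta>K \<alpha> - \<theta>K (\<alpha> + axis j 1)) * v \<alpha> $ j\<bar> \<le> (\<theta>K \<alpha> + \<theta>K (\<alpha> + axis j 1)) * c"
          unfolding abs_mult by (intro mult_mono) auto
        then show ?thesis by linarith
      qed
      then have "(\<Sum>j\<in>UNIV. (\<theta>K \<alpha> - \<theta>K (\<alpha> + axis j 1)) * v \<alpha> $ j) \<le>
          (\<Sum>j\<in>UNIV. (\<theta>K \<alpha> + \<theta>K (\<alpha> + axis j 1)) * c)"
        by (rule sum_mono)
      also have "\<dots> = bd \<alpha>"
        using 3 by (simp add: bd_def sum_distrib_left sum_distrib_right mult.commute)
      finally show ?thesis using en \<kappa>\<delta> by simp
    qed
  qed
  let ?\<Delta> = "sum \<theta> (B K) - sum \<theta> (B (K - 2))"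
  have \<Delta>: "?\<Delta> = sum \<theta>K (B K - B (K - 2))"
  proof -
    have "?\<Delta> = sum \<theta> (B K - B (K - 2))"
      using B_mono[of "K - 2" K] by (subst sum_diff) (auto simp: B_finite)
    also have "\<dots> = sum \<theta>K (B K - B (K - 2))"
      by (rule sum.cong) (auto simp: \<theta>K_def)
    finally show ?thesis .
  qed
  have bd_sum: "sum bd (B (K + 1)) \<le> 2 * real CARD('n) * c * ?\<Delta>"
  proof -
    have "sum bd (B (K + 1)) = sum bd (B (K + 1) - B (K - 1))"
      using B_finite by (intro sum.mono_neutral_right) (auto simp: bd_def)
    also have "\<dots> = (\<Sum>\<alpha>\<in>B (K + 1) - B (K - 1). \<Sum>j\<in>UNIV. c * (\<theta>K (\<alpha> + 0) + \<theta>K (\<alpha> + axis j 1)))"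
      by (rule sum.cong) (auto simp: bd_def sum_distrib_left)
    also have "\<dots> = (\<Sum>j\<in>UNIV. c * ((\<Sum>\<alpha>\<in>B (K + 1) - B (K - 1). \<theta>K (\<alpha> + 0)) +
        (\<Sum>\<alpha>\<in>B (K + 1) - B (K - 1). \<theta>K (\<alpha> + axis j 1))))"
      by (subst sum.swap) (simp only: sum_distrib_left[symmetric] sum.distrib)
    also have "\<dots> \<le> (\<Sum>j\<in>(UNIV::'n set). c * (?\<Delta> + ?\<Delta>))"
    proof (intro sum_mono mult_left_mono add_mono c)
      show "(\<Sum>\<alpha>\<in>B (K + 1) - B (K - 1). \<theta>K (\<alpha> + 0)) \<le> ?\<Delta>"
        unfolding \<Delta> using B_mono[of "K - 2" "K - 1"]
        by (intro sum_shift_le \<theta>K_nonneg) (auto simp: B_finite \<theta>K_def)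
      \<comment> \<open>A point outside \<open>B (K - 1)\<close> has its forward neighbours outside
        \<open>B (K - 2)\<close>, which fixes the inner radius of the shell.\<close>
      show "(\<Sum>\<alpha>\<in>B (K + 1) - B (K - 1). \<theta>K (\<alpha> + axis j 1)) \<le> ?\<Delta>" for j
        unfolding \<Delta> using B_minus[of _ j "K - 2"]
        by (intro sum_shift_le \<theta>K_nonneg) (auto simp: B_finite \<theta>K_def)
    qed
    finally show ?thesis by (simp add: algebra_simps)
  qed
  have "(\<Sum>\<alpha>\<in>B (K + 1). \<Sum>j\<in>UNIV. (\<theta>K \<alpha> - \<theta>K (\<alpha> + axis j 1)) * v \<alpha> $ j) \<le>
      (\<Sum>\<alpha>\<in>B (K + 1). \<kappa> \<alpha> * \<delta> \<alpha> + \<beta> / 4 * (of_bool (\<alpha> \<in> B (K - 1)) * cutoff_energy \<theta> \<alpha>) + bd \<alpha>)"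
    by (intro sum_mono pointwise)
  also have "\<dots> = (\<Sum>\<alpha>\<in>B (K + 1). \<kappa> \<alpha> * \<delta> \<alpha>)
      + \<beta> / 4 * (\<Sum>\<alpha>\<in>B (K + 1). of_bool (\<alpha> \<in> B (K - 1)) * cutoff_energy \<theta> \<alpha>) + sum bd (B (K + 1))"
    by (simp only: sum.distrib sum_distrib_left)
  also have "(\<Sum>\<alpha>\<in>B (K + 1). of_bool (\<alpha> \<in> B (K - 1)) * cutoff_energy \<theta> \<alpha>) =
      sum (cutoff_energy \<theta>) (B (K - 1))"
    using B_mono[of "K - 1" "K + 1"] by (intro sum.mono_neutral_cong_right) (auto simp: B_finite)
  finally have "(\<Sum>\<alpha>\<in>cube_boundary R. v \<alpha> \<bullet> cube_normal R \<alpha>) \<le>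
      (\<Sum>\<alpha>\<in>B (K + 1). \<kappa> \<alpha> * \<delta> \<alpha>) + \<beta> / 4 * sum (cutoff_energy \<theta>) (B (K - 1))
      + 2 * real CARD('n) * c * ?\<Delta> - (\<Sum>\<alpha>\<in>B (K + 1). \<kappa> \<alpha> * lattice_div v \<alpha>)"
    using bd_sum unfolding flux by linarith
  also have "(\<Sum>\<alpha>\<in>B (K + 1). \<kappa> \<alpha> * lattice_div v \<alpha>) =
      (\<Sum>\<alpha>\<in>B (K + 1). \<kappa> \<alpha> * (- \<delta> \<alpha> + lattice_div v \<alpha>)) + (\<Sum>\<alpha>\<in>B (K + 1). \<kappa> \<alpha> * \<delta> \<alpha>)"
    by (simp add: sum.distrib[symmetric] algebra_simps)
  finally show ?thesis
    unfolding B_def by linarith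
qed

section \<open>The flux through a cube and a cutoff function\<close>

context lattice_EDS
begin

lemma semiflow_in_space: "u \<in> topspace X \<Longrightarrow> 0 \<le> t \<Longrightarrow> \<phi> u t \<in> topspace X"
  using continuous_map_image_subset_topspace[OF continuous] by (auto simp: image_subset_iff)

lemma continuous_on_along_orbit:
  fixes g :: "'x \<Rightarrow> real"
  assumes "u \<in> topspace X" "continuous_map X euclidean g"
  shows "continuous_on {0..} (\<lambda>t. g (\<phi> u t))"
proof -
  have "continuous_map (top_of_set {0..}) (prod_topology X (top_of_set {0..})) (\<lambda>t. (u, t))"
    using assms(1) by (intro continuous_map_pairedI) (auto simp: continuous_map_const)
  then have "continuous_map (top_of_set {0..}) X (\<lambda>t. \<phi> u t)"
    using continuous_map_compose[OF _ continuous, of "top_of_set {0..}" "\<lambda>t. (u, t)"]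
    by (simp add: o_def)
  then have "continuous_map (top_of_set {0..}) euclidean (\<lambda>t. g (\<phi> u t))"
    using continuous_map_compose[OF _ assms(2), of "top_of_set {0..}" "\<phi> u"] by (simp add: o_def)
  then show ?thesis by simp
qed

lemma continuous_on_lattice_div:
  assumes "u \<in> topspace X"
  shows "continuous_on {0..} (\<lambda>t. lattice_div (f (\<phi> u t)) \<alpha>)"
  unfolding lattice_div_def
  by (intro continuous_on_sum continuous_on_diff continuous_on_along_orbit[OF assms] continuous_flux)

lemma integrated_energy_balance:
  assumes "u \<in> topspace X" "T > 0"
  shows "((\<lambda>t. - d (\<phi> u t) \<alpha> + lattice_div (f (\<phi> u t)) \<alpha>) has_integral
    e (\<phi> u T) \<alpha> - e (\<phi> u 0) \<alpha>) {0..T}"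
proof -
  have cont: "continuous_on {0..} (\<lambda>t. - d (\<phi> u t) \<alpha> + lattice_div (f (\<phi> u t)) \<alpha>)"
    using assms(1) by (intro continuous_on_add continuous_on_minus continuous_on_lattice_div
        continuous_on_along_orbit continuous_dissipation)
  then have "(\<lambda>t. - d (\<phi> u t) \<alpha> + lattice_div (f (\<phi> u t)) \<alpha>) integrable_on {0..T}"
    by (intro integrable_continuous_real) (auto intro: continuous_on_subset)
  moreover have "integral {0..T} (\<lambda>t. - d (\<phi> u t) \<alpha> + lattice_div (f (\<phi> u t)) \<alpha>) =
      e (\<phi> u T) \<alpha> - e (\<phi> u 0) \<alpha>"
    using assms(2) energy_balance[OF assms(1)] cont
      continuous_on_along_orbit[OF assms(1) continuous_energy]
    by (intro integral_distributional_derivative)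
  ultimately show ?thesis
    by (simp add: has_integral_iff)
qed

text \<open>S and G bound all finite partial sums and thus stand for the infinite mass and cost.
  Integrating in time, the energy balance becomes a change of energy weighted by \<kappa>, and the
  shell error vanishes as the box grows.\<close>

lemma boundary_flux_le:
  fixes \<theta> :: "int ^ 'n \<Rightarrow> real"
  assumes u: "u \<in> topspace X" and "T > 0" "R \<ge> 1"
    and \<beta>: "\<beta> \<ge> 0" "\<And>v. v \<in> topspace X \<Longrightarrow> b (norm (e v)) \<le> \<beta>"
    and \<theta>: "\<And>\<alpha>. \<theta> \<alpha> > 0" "\<And>\<alpha>. \<alpha> \<in> lattice_box (- R + 1) (R + 1) \<Longrightarrow> \<theta> \<alpha> = 1"
    and S: "\<And>A. finite A \<Longrightarrow> sum \<theta> A \<le> S"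
    and G: "\<And>A. finite A \<Longrightarrow> sum (cutoff_energy \<theta>) A \<le> G"
  shows "boundary_flux \<phi> f u R T \<le> \<beta> / 4 * G * T + norm (e (\<phi> u 0)) * S"
proof -
  \<comment> \<open>This bound is uniform over the lattice and over [0, T]. It may depend on T,
    since T is fixed while the truncation is removed.\<close>
  obtain c where c: "\<And>t. t \<in> {0..T} \<Longrightarrow> norm (f (\<phi> u t)) \<le> c"
  proof -
    have "continuous_on {0..T} (\<lambda>t. norm (f (\<phi> u t)))"
      using continuous_norm_flux[OF u] by (rule continuous_on_subset) auto
    then have "compact ((\<lambda>t. norm (f (\<phi> u t))) ` {0..T})"
      by (rule compact_continuous_image) simp
    then obtain M where "\<forall>x\<in>(\<lambda>t. norm (f (\<phi> u t))) ` {0..T}. norm x \<le> M"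
      using bounded_iff[THEN iffD1, OF compact_imp_bounded] by blast
    then show ?thesis by (intro that[of M]) auto
  qed
  define \<sigma> where "\<sigma> k = sum \<theta> (lattice_box (- int k) (int k))" for k
  have step: "boundary_flux \<phi> f u R T \<le> \<beta> / 4 * G * T + norm (e (\<phi> u 0)) * S +
      2 * real CARD('n) * c * T * (\<sigma> (k + 2) - \<sigma> k)" if "int k \<ge> R + 1" for k
  proof -
    \<comment> \<open>The shift by 2 makes the inner box \<open>K - 2\<close> of the shell error the
      box of \<open>\<sigma> k\<close>.\<close>
    define K where "K = int k + 2"
    have K: "K \<ge> R + 3" using that by (simp add: K_def)
    let ?B = "lattice_box (- (K + 1)) (K + 1) :: (int ^ 'n) set"
    define \<kappa> where "\<kappa> \<alpha> = of_bool (\<alpha> \<in> lattice_box (- K) K) * \<theta> \<alpha> -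
      of_bool (\<alpha> \<in> lattice_box (- R + 1) R)" for \<alpha>
    define h where "h \<alpha> t = - d (\<phi> u t) \<alpha> + lattice_div (f (\<phi> u t)) \<alpha>" for \<alpha> t
    define Q where "Q = \<beta> / 4 * G + 2 * real CARD('n) * c * (\<sigma> (k + 2) - \<sigma> k)"
    have "(\<lambda>t. \<Sum>\<alpha>\<in>cube_boundary R. f (\<phi> u t) \<alpha> \<bullet> cube_normal R \<alpha>) integrable_on {0..T}"
    proof (rule integrable_continuous_real)
      have "continuous_on {0..} (\<lambda>t. \<Sum>\<alpha>\<in>cube_boundary R. \<Sum>j\<in>UNIV. f (\<phi> u t) \<alpha> $ j * cube_normal R \<alpha> $ j)"
        by (intro continuous_on_sum continuous_on_mult_right continuous_on_along_orbit u continuous_flux)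
      then show "continuous_on {0..T} (\<lambda>t. \<Sum>\<alpha>\<in>cube_boundary R. f (\<phi> u t) \<alpha> \<bullet> cube_normal R \<alpha>)"
        unfolding inner_vec_def inner_real_def by (rule continuous_on_subset) simp
    qed
    then have 1: "((\<lambda>t. \<Sum>\<alpha>\<in>cube_boundary R. f (\<phi> u t) \<alpha> \<bullet> cube_normal R \<alpha>) has_integral
        boundary_flux \<phi> f u R T) {0..T}"
      unfolding boundary_flux_def by (rule integrable_integral)
    have 2: "((\<lambda>t. Q - (\<Sum>\<alpha>\<in>?B. \<kappa> \<alpha> * h \<alpha> t)) has_integral
        T * Q - (\<Sum>\<alpha>\<in>?B. \<kappa> \<alpha> * (e (\<phi> u T) \<alpha> - e (\<phi> u 0) \<alpha>))) {0..T}"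
    proof (intro has_integral_diff has_integral_sum has_integral_mult_right)
      show "((\<lambda>t. Q) has_integral T * Q) {0..T}"
        using has_integral_const_real[of Q 0 T] \<open>T > 0\<close> by simp
      show "(h \<alpha> has_integral e (\<phi> u T) \<alpha> - e (\<phi> u 0) \<alpha>) {0..T}" for \<alpha>
        unfolding h_def using u \<open>T > 0\<close> by (rule integrated_energy_balance)
    qed simp
    have "boundary_flux \<phi> f u R T \<le> T * Q - (\<Sum>\<alpha>\<in>?B. \<kappa> \<alpha> * (e (\<phi> u T) \<alpha> - e (\<phi> u 0) \<alpha>))"
    proof (rule has_integral_le[OF 1 2])
      fix t assume t: "t \<in> {0..T}"
      let ?w = "\<phi> u t"
      have w: "?w \<in> topspace X" using semiflow_in_space u t by simp
      have "(\<Sum>\<alpha>\<in>cube_boundary R. f ?w \<alpha> \<bullet> cube_normal R \<alpha>) \<le>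
        \<beta> / 4 * sum (cutoff_energy \<theta>) (lattice_box (- (K - 1)) (K - 1))
        + 2 * real CARD('n) * c * (sum \<theta> (lattice_box (- K) K) - sum \<theta> (lattice_box (- (K - 2)) (K - 2)))
        - (\<Sum>\<alpha>\<in>?B. \<kappa> \<alpha> * (- d ?w \<alpha> + lattice_div (f ?w) \<alpha>))"
      proof (rule cube_flux_le[OF \<open>R \<ge> 1\<close> K \<beta>(1)])
        show "(norm (f ?w \<alpha>))\<^sup>2 \<le> \<beta> * d ?w \<alpha>" for \<alpha>
          using flux_bound[OF w, of \<alpha>] mult_right_mono[OF \<beta>(2)[OF w] dissipation_nonneg[OF w, of \<alpha>]]
          by linarith
        show "norm (f ?w \<alpha>) \<le> c" for \<alpha>
          using c[OF t] norm_bounded order_trans by blast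
      qed (use \<theta> dissipation_nonneg[OF w] \<kappa>_def in auto)
      also have "\<dots> \<le> Q - (\<Sum>\<alpha>\<in>?B. \<kappa> \<alpha> * h \<alpha> t)"
      proof -
        have "\<beta> / 4 * sum (cutoff_energy \<theta>) (lattice_box (- (K - 1)) (K - 1)) \<le> \<beta> / 4 * G"
          using \<beta> G by (intro mult_left_mono) auto
        then show ?thesis
          by (simp add: Q_def \<sigma>_def K_def h_def add.commute)
      qed
      finally show "(\<Sum>\<alpha>\<in>cube_boundary R. f ?w \<alpha> \<bullet> cube_normal R \<alpha>) \<le> Q - (\<Sum>\<alpha>\<in>?B. \<kappa> \<alpha> * h \<alpha> t)" .
    qed
    \<comment> \<open>The final energy is nonnegative and may be dropped; the initial energy is
      weighted by \<kappa>, which lies between 0 and \<theta>.\<close>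
    moreover have "- (\<Sum>\<alpha>\<in>?B. \<kappa> \<alpha> * (e (\<phi> u T) \<alpha> - e (\<phi> u 0) \<alpha>)) \<le> norm (e (\<phi> u 0)) * S"
    proof -
      have "- (\<kappa> \<alpha> * (e (\<phi> u T) \<alpha> - e (\<phi> u 0) \<alpha>)) \<le> norm (e (\<phi> u 0)) * \<theta> \<alpha>" for \<alpha>
      proof -
        have sub: "\<alpha> \<in> lattice_box (- R + 1) R \<Longrightarrow> \<alpha> \<in> lattice_box (- R + 1) (R + 1) \<inter> lattice_box (- K) K"
          using lattice_box_mono[of "- R + 1" "- R + 1" R "R + 1"] lattice_box_mono[of "- K" "- R + 1" R K] K \<open>R \<ge> 1\<close>
          by auto
        have \<kappa>: "0 \<le> \<kappa> \<alpha>" "\<kappa> \<alpha> \<le> \<theta> \<alpha>"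
          using \<theta>(1)[of \<alpha>] \<theta>(2)[of \<alpha>] sub by (auto simp: \<kappa>_def)
        have "- (e (\<phi> u T) \<alpha> - e (\<phi> u 0) \<alpha>) \<le> norm (e (\<phi> u 0))"
          using energy_nonneg[OF semiflow_in_space[OF u, of T], of \<alpha>] \<open>T > 0\<close>
            norm_bounded[of "e (\<phi> u 0)" \<alpha>] by (simp add: abs_le_iff)
        then have "\<kappa> \<alpha> * (- (e (\<phi> u T) \<alpha> - e (\<phi> u 0) \<alpha>)) \<le> \<kappa> \<alpha> * norm (e (\<phi> u 0))"
          using \<kappa>(1) by (rule mult_left_mono)
        also have "\<dots> \<le> \<theta> \<alpha> * norm (e (\<phi> u 0))"
          using \<kappa>(2) by (intro mult_right_mono) auto
        finally show ?thesis by (simp add: algebra_simps)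
      qed
      then have "(\<Sum>\<alpha>\<in>?B. - (\<kappa> \<alpha> * (e (\<phi> u T) \<alpha> - e (\<phi> u 0) \<alpha>))) \<le> (\<Sum>\<alpha>\<in>?B. norm (e (\<phi> u 0)) * \<theta> \<alpha>)"
        by (rule sum_mono)
      also have "\<dots> \<le> norm (e (\<phi> u 0)) * S"
        unfolding sum_distrib_left[symmetric] using S by (intro mult_left_mono) auto
      finally show ?thesis by (simp add: sum_negf)
    qed
    ultimately have "boundary_flux \<phi> f u R T \<le> T * Q + norm (e (\<phi> u 0)) * S"
      by linarith
    then show ?thesis
      by (simp add: Q_def algebra_simps)
  qed
  \<comment> \<open>The masses of the boxes increase and are bounded by S, hence converge; so the
    mass of a shell of width 2 tends to 0.\<close>
  have "incseq \<sigma>"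
    unfolding \<sigma>_def
    by (intro incseq_SucI sum_mono2 lattice_box_mono) (auto intro: less_imp_le \<theta>)
  moreover have "\<sigma> k \<le> S" for k
    unfolding \<sigma>_def by (intro S) simp
  ultimately obtain l where l: "\<sigma> \<longlonglongrightarrow> l"
    using incseq_convergent by blast
  then have "(\<lambda>k. \<sigma> (k + 2)) \<longlonglongrightarrow> l"
    by (rule LIMSEQ_ignore_initial_segment)
  then have "(\<lambda>k. \<beta> / 4 * G * T + norm (e (\<phi> u 0)) * S + 2 * real CARD('n) * c * T * (\<sigma> (k + 2) - \<sigma> k)) \<longlonglongrightarrow>
      \<beta> / 4 * G * T + norm (e (\<phi> u 0)) * S + 2 * real CARD('n) * c * T * (l - l)"
    by (intro tendsto_intros l)
  then have "(\<lambda>k. \<beta> / 4 * G * T + norm (e (\<phi> u 0)) * S + 2 * real CARD('n) * c * T * (\<sigma> (k + 2) - \<sigma> k)) \<longlonglongrightarrow>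
      \<beta> / 4 * G * T + norm (e (\<phi> u 0)) * S"
    by simp
  then show ?thesis
  proof (rule LIMSEQ_le_const, intro exI allI impI)
    fix k assume "nat (R + 1) \<le> k"
    then show "boundary_flux \<phi> f u R T \<le> \<beta> / 4 * G * T + norm (e (\<phi> u 0)) * S +
        2 * real CARD('n) * c * T * (\<sigma> (k + 2) - \<sigma> k)"
      by (intro step) simp
  qed
qed

end

section \<open>Product cutoffs\<close>

lemma sum_expand_interval:
  fixes g :: "int \<Rightarrow> real"
  assumes "l \<le> r"
  shows "sum g {l - int (Suc n)..r + int (Suc n)} =
    sum g {l - int n..r + int n} + g (l - int (Suc n)) + g (r + int (Suc n))"
proof -
  have "{l - int (Suc n)..r + int (Suc n)} =
      insert (l - int (Suc n)) (insert (r + int (Suc n)) {l - int n..r + int n})"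
    using assms by auto
  then show ?thesis
    using assms by simp
qed

text \<open>The plateau reaches R + 1, one more than the cube, to include forward neighbours; on it
  \<open>nat\<close> cuts the nonpositive distance to 0. On a geometric tail the squared increment
  over the value is a multiple of the value, so mass and cost are both geometric series.\<close>

definition profile :: "int \<Rightarrow> real \<Rightarrow> int \<Rightarrow> real" where
  "profile R q k = q ^ nat (max (k - (R + 1)) (- R + 1 - k))"

lemma profile_eq_1: "- R + 1 \<le> k \<Longrightarrow> k \<le> R + 1 \<Longrightarrow> profile R q k = 1"
  by (simp add: profile_def)

lemma profile_right: "R \<ge> 1 \<Longrightarrow> profile R q (R + 1 + int n) = q ^ n"
  by (simp add: profile_def max_def)

lemma profile_left: "R \<ge> 1 \<Longrightarrow> profile R q (- R + 1 - int n) = q ^ n"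
  by (simp add: profile_def max_def)

lemma sum_profile:
  assumes "R \<ge> 1" "0 < q" "q < 1"
  shows "sum (profile R q) {- R + 1 - int n..R + 1 + int n} =
    2 * of_int R + 1 + 2 * (q - q ^ Suc n) / (1 - q)"
proof (induction n)
  case 0
  have "sum (profile R q) {- R + 1..R + 1} = sum (\<lambda>_. 1) {- R + 1..R + 1}"
    by (rule sum.cong) (auto simp: profile_eq_1)
  then show ?case using assms by simp
next
  case (Suc n)
  have "2 * (q - q ^ Suc n) / (1 - q) + 2 * q ^ Suc n = 2 * (q - q * q ^ Suc n) / (1 - q)"
    using assms by (simp add: field_simps)
  moreover have "- R + 1 \<le> R + 1"
    using assms by simp
  ultimately show ?case
    unfolding sum_expand_interval[OF \<open>- R + 1 \<le> R + 1\<close>] Suc profile_left[OF assms(1)] profile_right[OF assms(1)]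
    by simp
qed

definition profile_energy :: "int \<Rightarrow> real \<Rightarrow> int \<Rightarrow> real" where
  "profile_energy R q k = (profile R q (k + 1) - profile R q k)\<^sup>2 / profile R q k"

text \<open>The denominator is the larger of the two values on the right tail and the smaller on the
  left tail; hence the extra factor 1/q in only one term.\<close>

lemma sum_profile_energy:
  assumes "R \<ge> 1" "0 < q" "q < 1"
  shows "sum (profile_energy R q) {- R + 1 - int n..R + 1 + int n} =
    (1 - q) * (1 - q ^ Suc n) + (1 - q) * (1 - q ^ n) / q"
proof -
  have right: "profile_energy R q (R + 1 + int n) = q ^ n * (1 - q)\<^sup>2" for n
  proof -
    have "profile R q (R + 1 + int n + 1) = q ^ Suc n"
      using profile_right[of R q "Suc n"] assms by (simp add: add_ac)
    moreover have "profile R q (R + 1 + int n) = q ^ n"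
      using profile_right[of R q n] assms by simp
    ultimately have "profile_energy R q (R + 1 + int n) = (q ^ Suc n - q ^ n)\<^sup>2 / q ^ n"
      by (simp only: profile_energy_def)
    also have "\<dots> = q ^ n * (1 - q)\<^sup>2"
      using assms by (simp add: field_simps power2_eq_square)
    finally show ?thesis .
  qed
  have left: "profile_energy R q (- R + 1 - int (Suc n)) = q ^ n * (1 - q)\<^sup>2 / q" for n
  proof -
    have "profile R q (- R + 1 - int (Suc n) + 1) = q ^ n"
      using profile_left[of R q n] assms by (simp add: algebra_simps)
    moreover have "profile R q (- R + 1 - int (Suc n)) = q ^ Suc n"
      using profile_left[of R q "Suc n"] assms by simp
    ultimately have "profile_energy R q (- R + 1 - int (Suc n)) = (q ^ n - q ^ Suc n)\<^sup>2 / q ^ Suc n"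
      by (simp only: profile_energy_def)
    also have "\<dots> = q ^ n * (1 - q)\<^sup>2 / q"
      using assms by (simp add: field_simps power2_eq_square)
    finally show ?thesis .
  qed
  show ?thesis
  proof (induction n)
    case 0
    have "profile_energy R q k = 0" if "k \<in> {- R + 1..R}" for k
      using that by (simp add: profile_energy_def profile_eq_1)
    moreover have "{- R + 1..R + 1} = insert (R + 1) {- R + 1..R}"
      using assms by auto
    moreover have "profile_energy R q (R + 1) = (1 - q)\<^sup>2"
      using right[of 0] by simp
    ultimately show ?case
      by (simp add: power2_eq_square)
  next
    case (Suc n)
    have "(1 - q) * (1 - q ^ Suc n) + (1 - q) * (1 - q ^ n) / q + q ^ n * (1 - q)\<^sup>2 / q + q ^ Suc n * (1 - q)\<^sup>2 =
        (1 - q) * (1 - q * q ^ Suc n) + (1 - q) * (1 - q ^ Suc n) / q"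
      using assms by (simp add: field_simps power2_eq_square)
    moreover have "- R + 1 \<le> R + 1"
      using assms by simp
    ultimately show ?case
      unfolding sum_expand_interval[OF \<open>- R + 1 \<le> R + 1\<close>] Suc left right by simp
  qed
qed

definition product_cutoff :: "int \<Rightarrow> real \<Rightarrow> int ^ 'n::finite \<Rightarrow> real" where
  "product_cutoff R q \<alpha> = (\<Prod>j\<in>UNIV. profile R q (\<alpha> $ j))"

text \<open>A shift along axis j changes only the j-th factor; the others leave the square with one
  power cancelled by the denominator. Every summand is therefore again a product over
  coordinates.\<close>

lemma cutoff_energy_product_cutoff:
  fixes \<alpha> :: "int ^ 'n::finite"
  assumes "q > 0"
  shows "cutoff_energy (product_cutoff R q) \<alpha> =
    (\<Sum>j\<in>UNIV. \<Prod>i\<in>UNIV. if i = j then profile_energy R q (\<alpha> $ i) else profile R q (\<alpha> $ i))"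
  unfolding cutoff_energy_def
proof (rule sum.cong)
  fix j :: 'n
  let ?P = "\<Prod>i\<in>UNIV - {j}. profile R q (\<alpha> $ i)"
  have P: "?P > 0" using assms by (intro prod_pos) (simp add: profile_def)
  have 1: "product_cutoff R q \<alpha> = profile R q (\<alpha> $ j) * ?P"
    unfolding product_cutoff_def by (rule prod.remove) auto
  have 2: "product_cutoff R q (\<alpha> + axis j 1) = profile R q (\<alpha> $ j + 1) * ?P"
    unfolding product_cutoff_def by (subst prod.remove[of _ j]) (auto simp: axis_def)
  have "(\<Prod>i\<in>UNIV. if i = j then profile_energy R q (\<alpha> $ i) else profile R q (\<alpha> $ i)) =
      profile_energy R q (\<alpha> $ j) * ?P"
    by (subst prod.remove[of _ j]) auto
  also have "\<dots> = (profile R q (\<alpha> $ j + 1) * ?P - profile R q (\<alpha> $ j) * ?P)\<^sup>2 / (profile R q (\<alpha> $ j) * ?P)"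
    using P by (simp add: profile_energy_def left_diff_distrib[symmetric] power_mult_distrib)
      (simp add: power2_eq_square)
  finally show "(product_cutoff R q (\<alpha> + axis j 1) - product_cutoff R q \<alpha>)\<^sup>2 / product_cutoff R q \<alpha> =
      (\<Prod>i\<in>UNIV. if i = j then profile_energy R q (\<alpha> $ i) else profile R q (\<alpha> $ i))"
    by (simp add: 1 2)
qed simp

context lattice_EDS
begin

text \<open>Here \<tau> is the mass of one tail, and W bounds the mass of a one-dimensional profile:
  2R + 1 plateau points and two tails. The cost has an energy factor in one direction and a factor W
  in each other one.\<close>

lemma boundary_flux_le_product:
  assumes u: "u \<in> topspace X" and "T > 0" "R \<ge> 1" "\<tau> > 0"
    and \<beta>: "\<beta> \<ge> 0" "\<And>v. v \<in> topspace X \<Longrightarrow> b (norm (e v)) \<le> \<beta>"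
  defines "W \<equiv> 2 * real_of_int R + 1 + 2 * \<tau>"
  shows "boundary_flux \<phi> f u R T \<le>
    \<beta> / 4 * (real CARD('n) * ((1 / \<tau> + 1 / (1 + \<tau>)) * W ^ (CARD('n) - 1))) * T
    + norm (e (\<phi> u 0)) * W ^ CARD('n)"
proof (rule boundary_flux_le[OF u \<open>T > 0\<close> \<open>R \<ge> 1\<close> \<beta>])
  \<comment> \<open>Chosen so that the tail q + q^2 + ... has mass \<tau>.\<close>
  define q where "q = \<tau> / (1 + \<tau>)"
  have q: "0 < q" "q < 1" using \<open>\<tau> > 0\<close> by (auto simp: q_def)
  have q_cost: "(1 - q) + (1 - q) / q = 1 / \<tau> + 1 / (1 + \<tau>)" and q_mass: "2 * q / (1 - q) = 2 * \<tau>"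
    using \<open>\<tau> > 0\<close> by (simp_all add: q_def field_simps)
  let ?\<theta> = "product_cutoff R q :: int ^ 'n \<Rightarrow> real"
  have pos: "profile R q k > 0" for k
    using q by (simp add: profile_def)
  have W: "sum (profile R q) {- R + 1 - int n..R + 1 + int n} \<le> W" for n
  proof -
    have "2 * (q - q ^ Suc n) / (1 - q) \<le> 2 * q / (1 - q)"
      using q by (intro divide_right_mono) auto
    then show ?thesis
      unfolding sum_profile[OF \<open>R \<ge> 1\<close> q] W_def q_mass by linarith
  qed
  have E: "sum (profile_energy R q) {- R + 1 - int n..R + 1 + int n} \<le> 1 / \<tau> + 1 / (1 + \<tau>)" for n
  proof -
    have "(1 - q) * (1 - q ^ Suc n) \<le> 1 - q" "(1 - q) * (1 - q ^ n) / q \<le> (1 - q) / q"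
      using q by (auto intro!: divide_right_mono mult_left_le)
    then show ?thesis
      unfolding sum_profile_energy[OF \<open>R \<ge> 1\<close> q] q_cost[symmetric] by linarith
  qed
  have E_nonneg: "profile_energy R q k \<ge> 0" for k
    using pos[of k] by (simp add: profile_energy_def)
  show \<theta>_pos: "?\<theta> \<alpha> > 0" for \<alpha>
    unfolding product_cutoff_def using pos by (intro prod_pos) auto
  show "?\<theta> \<alpha> = 1" if "\<alpha> \<in> lattice_box (- R + 1) (R + 1)" for \<alpha>
    using that unfolding product_cutoff_def lattice_box_def by (auto simp: profile_eq_1 intro!: prod.neutral)
  have in_box: "\<exists>n. A \<subseteq> lattice_box (- R + 1 - int n) (R + 1 + int n)" if "finite A" for A :: "(int ^ 'n) set"
  proof -
    obtain K where K: "K \<ge> 0" "A \<subseteq> lattice_box (- K) K"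
      using finite_subset_lattice_box[OF \<open>finite A\<close>] by blast
    then show ?thesis
      using lattice_box_mono[of "- R + 1 - int (nat K)" "- K" K "R + 1 + int (nat K)"] \<open>R \<ge> 1\<close>
      by (intro exI[of _ "nat K"]) auto
  qed
  show "sum ?\<theta> A \<le> W ^ CARD('n)" if "finite A" for A
  proof -
    obtain n where "A \<subseteq> lattice_box (- R + 1 - int n) (R + 1 + int n)"
      using in_box[OF \<open>finite A\<close>] by blast
    then have "sum ?\<theta> A \<le> sum ?\<theta> (lattice_box (- R + 1 - int n) (R + 1 + int n))"
      by (intro sum_mono2) (auto intro: less_imp_le \<theta>_pos)
    also have "\<dots> = (sum (profile R q) {- R + 1 - int n..R + 1 + int n}) ^ CARD('n)"
      unfolding product_cutoff_def sum_lattice_box_prod[where g = "\<lambda>_. profile R q"] by simp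
    also have "\<dots> \<le> W ^ CARD('n)"
      by (rule power_mono[OF W]) (simp add: sum_nonneg less_imp_le pos)
    finally show ?thesis .
  qed
  show "sum (cutoff_energy ?\<theta>) A \<le> real CARD('n) * ((1 / \<tau> + 1 / (1 + \<tau>)) * W ^ (CARD('n) - 1))"
    if "finite A" for A
  proof -
    obtain n where n: "A \<subseteq> lattice_box (- R + 1 - int n) (R + 1 + int n)"
      using in_box[OF \<open>finite A\<close>] by blast
    let ?I = "{- R + 1 - int n..R + 1 + int n}"
    have "sum (cutoff_energy ?\<theta>) A \<le> sum (cutoff_energy ?\<theta>) (lattice_box (- R + 1 - int n) (R + 1 + int n))"
      using n by (intro sum_mono2) (auto intro: cutoff_energy_nonneg \<theta>_pos)
    also have "\<dots> = (\<Sum>j\<in>(UNIV::'n set). \<Sum>\<alpha>\<in>lattice_box (- R + 1 - int n) (R + 1 + int n).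
        \<Prod>i\<in>UNIV. if i = j then profile_energy R q (\<alpha> $ i) else profile R q (\<alpha> $ i))"
      unfolding cutoff_energy_product_cutoff[OF \<open>q > 0\<close>] by (rule sum.swap)
    also have "\<dots> = (\<Sum>j\<in>(UNIV::'n set). \<Prod>i\<in>UNIV.
        \<Sum>k\<in>?I. if i = j then profile_energy R q k else profile R q k)"
      by (simp only: sum_lattice_box_prod[where g = "\<lambda>i k. if i = _ then profile_energy R q k else profile R q k"])
    also have "\<dots> = (\<Sum>j\<in>(UNIV::'n set). sum (profile_energy R q) ?I * sum (profile R q) ?I ^ (CARD('n) - 1))"
    proof (rule sum.cong[OF refl])
      fix j :: 'n
      show "(\<Prod>i\<in>UNIV. \<Sum>k\<in>?I. if i = j then profile_energy R q k else profile R q k) =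
          sum (profile_energy R q) ?I * sum (profile R q) ?I ^ (CARD('n) - 1)"
        by (subst prod.remove[of _ j]) (simp_all add: card_Diff_singleton)
    qed
    also have "\<dots> \<le> (\<Sum>j\<in>(UNIV::'n set). (1 / \<tau> + 1 / (1 + \<tau>)) * W ^ (CARD('n) - 1))"
      using \<open>\<tau> > 0\<close>
      by (intro sum_mono mult_mono power_mono W E) (simp_all add: sum_nonneg E_nonneg less_imp_le pos)
    finally show ?thesis by simp
  qed
qed

end

section \<open>Logarithmic cutoffs in the plane\<close>

definition lattice_norm :: "int ^ 'n::finite \<Rightarrow> nat" where
  "lattice_norm \<alpha> = nat (Max (range (\<lambda>j. \<bar>\<alpha> $ j\<bar>)))"

lemma lattice_norm_le_iff: "lattice_norm \<alpha> \<le> k \<longleftrightarrow> \<alpha> \<in> lattice_box (- int k) (int k)"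
  by (simp add: lattice_norm_def nat_le_iff mem_lattice_box_abs_iff)

lemma lattice_norm_add_axis:
  shows "lattice_norm (\<alpha> + axis j 1) \<le> lattice_norm \<alpha> + 1"
    and "lattice_norm \<alpha> \<le> lattice_norm (\<alpha> + axis j 1) + 1"
proof -
  have shift: "(\<alpha> + axis j 1) $ i = \<alpha> $ i + of_bool (i = j)" for i
    by (auto simp: axis_def)
  have "\<alpha> \<in> lattice_box (- int k) (int k) \<Longrightarrow> \<alpha> + axis j 1 \<in> lattice_box (- int (k + 1)) (int (k + 1))" for k
    unfolding lattice_box_def mem_Collect_eq shift by (smt (verit) of_bool_eq of_nat_add of_nat_1)
  then show "lattice_norm (\<alpha> + axis j 1) \<le> lattice_norm \<alpha> + 1"
    using lattice_norm_le_iff by blast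
  have "\<alpha> + axis j 1 \<in> lattice_box (- int k) (int k) \<Longrightarrow> \<alpha> \<in> lattice_box (- int (k + 1)) (int (k + 1))" for k
    unfolding lattice_box_def mem_Collect_eq shift by (smt (verit) of_bool_eq of_nat_add of_nat_1)
  then show "lattice_norm \<alpha> \<le> lattice_norm (\<alpha> + axis j 1) + 1"
    using lattice_norm_le_iff by blast
qed

lemma card_lattice_box:
  "real (card (lattice_box l r :: (int ^ 'n::finite) set)) = real (card {l..r}) ^ CARD('n)"
  using sum_lattice_box_prod[of "\<lambda>(_::'n) _. 1" l r] by simp

text \<open>The sphere of radius r >= 1 in the maximum norm has (2r + 1)^2 - (2r - 1)^2 = 8r
  points.\<close>

lemma sum_lattice_norm_planar:
  fixes g :: "nat \<Rightarrow> real"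
  assumes "CARD('n::finite) = 2"
  shows "(\<Sum>\<alpha>\<in>(lattice_box (- int k) (int k) :: (int ^ 'n) set). g (lattice_norm \<alpha>)) =
    g 0 + (\<Sum>r\<in>{1..k}. 8 * real r * g r)"
proof (induction k)
  case 0
  have "lattice_box 0 0 = {0 :: int ^ 'n}"
    by (auto simp: lattice_box_def vec_eq_iff) (metis order_antisym)
  moreover have "lattice_norm (0 :: int ^ 'n) = 0"
    by (simp add: lattice_norm_def)
  ultimately show ?case by simp
next
  case (Suc k)
  let ?B = "\<lambda>k. lattice_box (- int k) (int k) :: (int ^ 'n) set"
  have sub: "?B k \<subseteq> ?B (Suc k)"
    by (rule lattice_box_mono) auto
  have norm: "lattice_norm \<alpha> = Suc k" if "\<alpha> \<in> ?B (Suc k) - ?B k" for \<alpha>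
    using that lattice_norm_le_iff[of \<alpha> k] lattice_norm_le_iff[of \<alpha> "Suc k"] by auto
  have "real (card (?B (Suc k) - ?B k)) = real (card (?B (Suc k))) - real (card (?B k))"
    using card_mono[OF finite_lattice_box sub]
    by (simp only: card_Diff_subset[OF finite_lattice_box sub] of_nat_diff)
  also have "\<dots> = 8 * real (Suc k)"
    unfolding card_lattice_box assms by (simp add: power2_eq_square algebra_simps)
  finally have card: "real (card (?B (Suc k) - ?B k)) = 8 * real (Suc k)" .
  have "(\<Sum>\<alpha>\<in>?B (Suc k). g (lattice_norm \<alpha>)) =
      (\<Sum>\<alpha>\<in>?B (Suc k) - ?B k. g (lattice_norm \<alpha>)) + (\<Sum>\<alpha>\<in>?B k. g (lattice_norm \<alpha>))"
    by (rule sum.subset_diff[OF sub]) simp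
  also have "(\<Sum>\<alpha>\<in>?B (Suc k) - ?B k. g (lattice_norm \<alpha>)) = (\<Sum>\<alpha>\<in>?B (Suc k) - ?B k. g (Suc k))"
    by (rule sum.cong) (auto simp: norm)
  also have "\<dots> = 8 * real (Suc k) * g (Suc k)"
    using card by simp
  finally show ?case
    using Suc by simp
qed

lemma sum_lattice_norm_planar_le:
  fixes g :: "nat \<Rightarrow> real" and h :: "int ^ 'n::finite \<Rightarrow> real"
  assumes "CARD('n) = 2" "finite A" "\<And>\<alpha>. h \<alpha> \<ge> 0" "\<And>\<alpha>. h \<alpha> \<le> g (lattice_norm \<alpha>)"
    and "\<And>k. g 0 + (\<Sum>r\<in>{1..k}. 8 * real r * g r) \<le> S"
  shows "sum h A \<le> S"
proof -
  obtain K where K: "K \<ge> 0" "A \<subseteq> lattice_box (- K) K"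
    using finite_subset_lattice_box[OF assms(2)] by blast
  have "sum h A \<le> sum h (lattice_box (- K) K)"
    using K assms by (intro sum_mono2) auto
  also have "\<dots> \<le> (\<Sum>\<alpha>\<in>(lattice_box (- K) K :: (int ^ 'n) set). g (lattice_norm \<alpha>))"
    by (intro sum_mono assms(4))
  also have "\<dots> = g 0 + (\<Sum>r\<in>{1..nat K}. 8 * real r * g r)"
    using sum_lattice_norm_planar[OF assms(1), of g "nat K"] K by simp
  also have "\<dots> \<le> S" by (rule assms)
  finally show ?thesis .
qed

section \<open>The logarithmic profile\<close>

text \<open>Passing from r + 1 to r multiplies 1 + (M/r)^2 by at most ((r + 1)/r)^2, and the
  logarithm of that factor is at most 2/r. This is the discrete form of a derivative bounded by
  2/r.\<close>

lemma ln_one_plus_square_diff_le: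
  fixes M r :: real
  assumes "r > 0"
  shows "r * (ln (1 + (M / r)\<^sup>2) - ln (1 + (M / (r + 1))\<^sup>2)) \<le> 2"
proof -
  have pos: "1 + (M / (r + 1))\<^sup>2 > 0"
    by (simp add: add_pos_nonneg)
  have "1 + (M / r)\<^sup>2 \<le> ((r + 1) / r)\<^sup>2 * (1 + (M / (r + 1))\<^sup>2)"
  proof -
    have "(M / r)\<^sup>2 = ((r + 1) / r)\<^sup>2 * (M / (r + 1))\<^sup>2"
      using assms by (simp add: power_mult_distrib[symmetric])
    moreover have "1 \<le> ((r + 1) / r)\<^sup>2"
      using assms by (simp add: field_simps)
    ultimately show ?thesis
      by (simp add: distrib_left)
  qed
  then have "ln (1 + (M / r)\<^sup>2) \<le> ln (((r + 1) / r)\<^sup>2 * (1 + (M / (r + 1))\<^sup>2))"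
    by (intro ln_mono) (simp_all add: add_pos_nonneg)
  also have "\<dots> = 2 * ln (1 + 1 / r) + ln (1 + (M / (r + 1))\<^sup>2)"
  proof -
    have "(r + 1) / r = 1 + 1 / r" "1 + 1 / r > 0"
      using assms by (auto simp: add_divide_distrib add_pos_pos)
    then show ?thesis
      using pos by (simp add: ln_mult ln_realpow)
  qed
  also have "ln (1 + 1 / r) \<le> 1 / r"
    using assms by (intro ln_add_one_self_le_self) auto
  finally show ?thesis
    using assms by (simp add: field_simps)
qed

text \<open>Close to 2 ln (M/r) for r far below M, as for the planar capacity potential, and to
  (M/r)^2 far above. It thus stays positive, and its square is summable over the plane. Clipping at
  R0 gives the plateau.\<close>

definition log_profile :: "nat \<Rightarrow> real \<Rightarrow> nat \<Rightarrow> real" where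
  "log_profile R0 M r = ln (1 + (M / real (max r R0))\<^sup>2)"

lemma log_profile_pos: "R0 > 0 \<Longrightarrow> M > 0 \<Longrightarrow> log_profile R0 M r > 0"
  unfolding log_profile_def by (intro ln_gt_zero) simp

lemma log_profile_antimono:
  assumes "R0 > 0" "M > 0" "r \<le> s"
  shows "log_profile R0 M s \<le> log_profile R0 M r"
  unfolding log_profile_def using assms
  by (intro ln_mono add_left_mono power_mono divide_left_mono) (auto simp: add_pos_nonneg max_def)

lemma log_profile_step:
  assumes "R0 > 0"
  shows "real r * (log_profile R0 M r - log_profile R0 M (Suc r)) \<le> 2"
proof (cases "r < R0")
  case True
  then have "max r R0 = R0" "max (Suc r) R0 = R0" by auto
  then show ?thesis by (simp add: log_profile_def)
next
  case False
  then show ?thesis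
    using ln_one_plus_square_diff_le[of "real r" M] assms
    by (simp add: log_profile_def max_def add.commute)
qed

text \<open>For r >= 3 one has ((r + 1)/r)^2 <= 2, and 1 + 2x <= (1 + x)^2. The bound serves the
  inward neighbours, where the cost divides by the smaller value.\<close>

lemma log_profile_doubling:
  assumes "R0 \<ge> 3" "M > 0"
  shows "log_profile R0 M r \<le> 2 * log_profile R0 M (Suc r)"
proof (cases "r < R0")
  case True
  then have "max r R0 = R0" "max (Suc r) R0 = R0" by auto
  then show ?thesis
    using log_profile_pos[of R0 M r] assms by (simp add: log_profile_def)
next
  case False
  define x where "x = (M / real (Suc r))\<^sup>2"
  have r: "real r \<ge> 3" using False assms by simp
  have "(M / real r)\<^sup>2 = ((real r + 1) / real r)\<^sup>2 * x"
    using r by (simp add: x_def power_mult_distrib[symmetric] add.commute)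
  also have "((real r + 1) / real r)\<^sup>2 \<le> 2"
  proof -
    have "3 * real r \<le> real r * real r" using r by (intro mult_right_mono) auto
    moreover have "(real r + 1)\<^sup>2 = real r * real r + 2 * real r + 1" "2 * (real r)\<^sup>2 = 2 * (real r * real r)"
      by (simp_all add: power2_eq_square algebra_simps)
    ultimately have "(real r + 1)\<^sup>2 \<le> 2 * (real r)\<^sup>2"
      using r by linarith
    then show ?thesis using r by (simp add: power_divide divide_le_eq)
  qed
  finally have "(M / real r)\<^sup>2 \<le> 2 * x"
    by (simp add: x_def mult_right_mono)
  moreover have "(1 + x)\<^sup>2 = 1 + 2 * x + x\<^sup>2"
    by (simp add: power2_sum)
  ultimately have "1 + (M / real r)\<^sup>2 \<le> (1 + x)\<^sup>2"
    using zero_le_power2[of x] by linarith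
  then have "ln (1 + (M / real r)\<^sup>2) \<le> ln ((1 + x)\<^sup>2)"
    by (intro ln_mono) (auto simp: add_pos_nonneg)
  also have "\<dots> = 2 * ln (1 + x)"
    by (subst ln_realpow) (auto simp: x_def add_pos_nonneg)
  finally show ?thesis
    using False by (simp add: log_profile_def max_def x_def)
qed

text \<open>For a squared function the denominator cancels: the quotient is ((y + x)/x)^2 (y - x)^2
  / L^2, and y <= c x bounds the first factor.\<close>

lemma square_diff_le:
  fixes x y c L :: real
  assumes "x > 0" "y > 0" "L > 0" "y \<le> c * x"
  shows "((y / L)\<^sup>2 - (x / L)\<^sup>2)\<^sup>2 / (x / L)\<^sup>2 \<le> (1 + c)\<^sup>2 * (y - x)\<^sup>2 / L\<^sup>2"
proof -
  have "((y / L)\<^sup>2 - (x / L)\<^sup>2)\<^sup>2 / (x / L)\<^sup>2 = ((y + x) / x)\<^sup>2 * (y - x)\<^sup>2 / L\<^sup>2"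
    using assms by (simp add: field_simps power2_eq_square)
  also have "\<dots> \<le> (1 + c)\<^sup>2 * (y - x)\<^sup>2 / L\<^sup>2"
    using assms by (intro divide_right_mono mult_right_mono power_mono) (auto simp: field_simps)
  finally show ?thesis .
qed

definition log_cutoff :: "nat \<Rightarrow> real \<Rightarrow> int ^ 'n::finite \<Rightarrow> real" where
  "log_cutoff R0 M \<alpha> = (log_profile R0 M (lattice_norm \<alpha>) / log_profile R0 M 0)\<^sup>2"

text \<open>Outwards the profile decreases, so \<open>square_diff_le\<close> applies with c = 1 and
  gives 4; inwards it at most doubles, so c = 2 gives 9. Adding both covers every direction. At r =
  0 the inward term vanishes because \<open>r - 1\<close> is 0.\<close>

lemma cutoff_energy_log_cutoff:
  fixes \<alpha> :: "int ^ 'n::finite"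
  assumes "R0 \<ge> 3" "M > 0"
  defines "P \<equiv> log_profile R0 M" and "r \<equiv> lattice_norm \<alpha>"
  shows "cutoff_energy (log_cutoff R0 M) \<alpha> \<le>
    real CARD('n) * ((9 * (P (r - 1) - P r)\<^sup>2 + 4 * (P r - P (Suc r))\<^sup>2) / (P 0)\<^sup>2)"
proof -
  have pos: "P s > 0" for s
    unfolding P_def using assms by (intro log_profile_pos) auto
  have "(log_cutoff R0 M (\<alpha> + axis j 1) - log_cutoff R0 M \<alpha>)\<^sup>2 / log_cutoff R0 M \<alpha> \<le>
      (9 * (P (r - 1) - P r)\<^sup>2 + 4 * (P r - P (Suc r))\<^sup>2) / (P 0)\<^sup>2" for j
  proof -
    define s where "s = lattice_norm (\<alpha> + axis j 1)"
    have lhs: "(log_cutoff R0 M (\<alpha> + axis j 1) - log_cutoff R0 M \<alpha>)\<^sup>2 / log_cutoff R0 M \<alpha> =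
        ((P s / P 0)\<^sup>2 - (P r / P 0)\<^sup>2)\<^sup>2 / (P r / P 0)\<^sup>2"
      by (simp add: log_cutoff_def P_def r_def s_def)
    have "s \<le> r + 1" "r \<le> s + 1"
      unfolding s_def r_def by (rule lattice_norm_add_axis)+
    then consider "s = r" | "s = Suc r" | "r = Suc s" by linarith
    then show ?thesis
    proof cases
      case 1
      then show ?thesis unfolding lhs by simp
    next
      case 2
      have "P (Suc r) \<le> 1 * P r"
        unfolding P_def using assms by (simp add: log_profile_antimono)
      then have "((P s / P 0)\<^sup>2 - (P r / P 0)\<^sup>2)\<^sup>2 / (P r / P 0)\<^sup>2 \<le> (1 + 1)\<^sup>2 * (P s - P r)\<^sup>2 / (P 0)\<^sup>2"
        using 2 by (intro square_diff_le pos) simp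
      also have "\<dots> \<le> (9 * (P (r - 1) - P r)\<^sup>2 + 4 * (P r - P (Suc r))\<^sup>2) / (P 0)\<^sup>2"
        using 2 by (intro divide_right_mono) (auto simp: power2_commute)
      finally show ?thesis unfolding lhs .
    next
      case 3
      have "P s \<le> 2 * P r"
        unfolding P_def 3 using assms by (intro log_profile_doubling)
      then have "((P s / P 0)\<^sup>2 - (P r / P 0)\<^sup>2)\<^sup>2 / (P r / P 0)\<^sup>2 \<le> (1 + 2)\<^sup>2 * (P s - P r)\<^sup>2 / (P 0)\<^sup>2"
        by (intro square_diff_le pos)
      also have "\<dots> \<le> (9 * (P (r - 1) - P r)\<^sup>2 + 4 * (P r - P (Suc r))\<^sup>2) / (P 0)\<^sup>2"
        using 3 by (intro divide_right_mono) auto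
      finally show ?thesis unfolding lhs .
    qed
  qed
  then have "cutoff_energy (log_cutoff R0 M) \<alpha> \<le>
      (\<Sum>j\<in>(UNIV::'n set). (9 * (P (r - 1) - P r)\<^sup>2 + 4 * (P r - P (Suc r))\<^sup>2) / (P 0)\<^sup>2)"
    unfolding cutoff_energy_def by (rule sum_mono)
  then show ?thesis by simp
qed

text \<open>
  Since \<open>r (P r - P (r + 1)) \<le> 2\<close>, one factor of each squared increment cancels the shell size
  \<open>8 r\<close> and the remaining sum of increments telescopes.
\<close>

lemma sum_log_profile_energy:
  assumes "R0 \<ge> 20" "M > 0"
  defines "P \<equiv> log_profile R0 M"
  shows "(\<Sum>r\<in>{1..k}. 8 * real r * (2 * ((9 * (P (r - 1) - P r)\<^sup>2 + 4 * (P r - P (Suc r))\<^sup>2) / (P 0)\<^sup>2)))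
    \<le> 431 / P 0"
proof -
  have pos: "P s > 0" for s
    unfolding P_def using assms by (intro log_profile_pos) auto
  have D_nonneg: "P s - P (Suc s) \<ge> 0" for s
    unfolding P_def using assms by (simp add: log_profile_antimono)
  have step: "real s * (P s - P (Suc s)) \<le> 2" for s
    unfolding P_def using assms by (intro log_profile_step) auto
  \<comment> \<open>The shell index of an inward increment is one larger. Increments vanish below R0
    >= 20, so this costs at most a factor 21/20.\<close>
  have step': "real (Suc s) * (P s - P (Suc s)) \<le> 21 / 10" for s
  proof (cases "s < R0")
    case True
    then have "max s R0 = R0" "max (Suc s) R0 = R0" by auto
    then show ?thesis by (simp add: P_def log_profile_def)
  next
    case False
    then have "real (Suc s) \<le> 21 / 20 * real s" using assms by simp
    then have "real (Suc s) * (P s - P (Suc s)) \<le> 21 / 20 * real s * (P s - P (Suc s))"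
      using D_nonneg by (rule mult_right_mono)
    then show ?thesis using step[of s] by simp
  qed
  \<comment> \<open>The coefficients are 9 * 21/10 = 189/10 and 4 * 2 = 8; the inner factor 2 is the
    dimension.\<close>
  have each: "8 * real r * (2 * ((9 * (P (r - 1) - P r)\<^sup>2 + 4 * (P r - P (Suc r))\<^sup>2) / (P 0)\<^sup>2)) \<le>
      16 / (P 0)\<^sup>2 * (189 / 10 * (P (r - 1) - P r) + 8 * (P r - P (Suc r)))" if "r \<in> {1..k}" for r
  proof -
    obtain s where r: "r = Suc s" using \<open>r \<in> {1..k}\<close> by (cases r) auto
    have 1: "real (Suc s) * (P s - P (Suc s))\<^sup>2 \<le> 21 / 10 * (P s - P (Suc s))"
      using mult_right_mono[OF step'[of s] D_nonneg[of s]] by (simp add: power2_eq_square mult.assoc)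
    have 2: "real r * (P r - P (Suc r))\<^sup>2 \<le> 2 * (P r - P (Suc r))"
      using mult_right_mono[OF step[of r] D_nonneg[of r]] by (simp add: power2_eq_square mult.assoc)
    have "8 * real r * (2 * ((9 * (P (r - 1) - P r)\<^sup>2 + 4 * (P r - P (Suc r))\<^sup>2) / (P 0)\<^sup>2)) =
        16 / (P 0)\<^sup>2 * (9 * (real r * (P (r - 1) - P r)\<^sup>2) + 4 * (real r * (P r - P (Suc r))\<^sup>2))"
      by (simp add: algebra_simps add_divide_distrib)
    also have "\<dots> \<le> 16 / (P 0)\<^sup>2 * (189 / 10 * (P (r - 1) - P r) + 8 * (P r - P (Suc r)))"
      using 1 2 unfolding r diff_Suc_1 by (intro mult_left_mono) (linarith, simp)
    finally show ?thesis .
  qed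
  have tele: "(\<Sum>r\<in>{1..k}. 189 / 10 * (P (r - 1) - P r) + 8 * (P r - P (Suc r))) =
      189 / 10 * (P 0 - P k) + 8 * (P 1 - P (Suc k))"
  proof (induction k)
    case (Suc k)
    show ?case
      unfolding sum.cl_ivl_Suc Suc by (simp add: field_simps)
  qed simp
  have "(\<Sum>r\<in>{1..k}. 8 * real r * (2 * ((9 * (P (r - 1) - P r)\<^sup>2 + 4 * (P r - P (Suc r))\<^sup>2) / (P 0)\<^sup>2))) \<le>
      16 / (P 0)\<^sup>2 * (189 / 10 * (P 0 - P k) + 8 * (P 1 - P (Suc k)))"
    unfolding tele[symmetric] sum_distrib_left by (intro sum_mono each)
  \<comment> \<open>Since P 1 <= P 0, the bracket is at most (18.9 + 8) P 0, and 16 * 26.9 = 430.4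
    is rounded up to 431.\<close>
  also have "\<dots> \<le> 16 / (P 0)\<^sup>2 * (431 / 16 * P 0)"
  proof (rule mult_left_mono)
    show "189 / 10 * (P 0 - P k) + 8 * (P 1 - P (Suc k)) \<le> 431 / 16 * P 0"
      using pos[of k] pos[of "Suc k"] D_nonneg[of 0] pos[of 0] unfolding One_nat_def by argo
  qed simp
  also have "\<dots> = 431 / P 0"
    using pos[of 0] by (simp add: power2_eq_square)
  finally show ?thesis .
qed

text \<open>For r <= M the rational bound is at least 1; for r > M use ln (1 + x) <= x and a
  normalising constant of at least 1. A rational majorant is chosen because its shell sums can be
  telescoped.\<close>

lemma log_cutoff_le:
  fixes \<alpha> :: "int ^ 'n::finite"
  assumes "R0 > 0" "M > 0" "log_profile R0 M 0 \<ge> 1"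
  shows "log_cutoff R0 M \<alpha> \<le>
    (if lattice_norm \<alpha> < R0 then 1 else 4 * M ^ 4 / (M\<^sup>2 + (real (lattice_norm \<alpha>))\<^sup>2)\<^sup>2)"
proof -
  define r where "r = lattice_norm \<alpha>"
  define P where "P = log_profile R0 M"
  have pos: "P s > 0" for s
    unfolding P_def using assms by (intro log_profile_pos)
  have le1: "P r / P 0 \<le> 1"
    unfolding P_def using assms pos[of 0] by (simp add: log_profile_antimono P_def)
  show ?thesis
  proof (cases "r < R0")
    case True
    then show ?thesis
      using le1 pos[of r] pos[of 0] by (simp add: log_cutoff_def r_def P_def power_le_one)
  next
    case False
    then have "real r > 0" using assms by simp
    have "P r / P 0 \<le> 2 * M\<^sup>2 / (M\<^sup>2 + (real r)\<^sup>2)"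
    proof (cases "real r \<le> M")
      case True
      then have "(real r)\<^sup>2 \<le> M\<^sup>2" by simp
      then have "1 \<le> 2 * M\<^sup>2 / (M\<^sup>2 + (real r)\<^sup>2)"
        using assms by (simp add: field_simps add_pos_nonneg)
      then show ?thesis using le1 by linarith
    next
      case r: False
      have "P r / P 0 \<le> P r"
        using assms(3) pos[of r] by (simp add: P_def divide_le_eq mult_le_cancel_left1)
      also have "P r \<le> (M / real r)\<^sup>2"
        using False by (simp add: P_def log_profile_def max_def ln_add_one_self_le_self)
      also have "\<dots> \<le> 2 * M\<^sup>2 / (M\<^sup>2 + (real r)\<^sup>2)"
      proof -
        have "M\<^sup>2 \<le> (real r)\<^sup>2" using r assms by (intro power_mono) auto
        then have "M\<^sup>2 * (M\<^sup>2 + (real r)\<^sup>2) \<le> M\<^sup>2 * (2 * (real r)\<^sup>2)"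
          by (intro mult_left_mono) auto
        then show ?thesis
          using \<open>real r > 0\<close> assms by (simp add: power_divide field_simps add_pos_pos)
      qed
      finally show ?thesis .
    qed
    then have "(P r / P 0)\<^sup>2 \<le> (2 * M\<^sup>2 / (M\<^sup>2 + (real r)\<^sup>2))\<^sup>2"
      using pos[of r] pos[of 0] by (intro power_mono) auto
    also have "\<dots> = 4 * M ^ 4 / (M\<^sup>2 + (real r)\<^sup>2)\<^sup>2"
      by (simp add: power_divide power_mult_distrib flip: power_mult)
    finally show ?thesis
      using False by (simp add: log_cutoff_def r_def P_def)
  qed
qed

lemma sum_log_cutoff_bound:
  fixes M :: real
  assumes "R0 > 0" "M > 0"
  shows "(\<Sum>r\<in>{1..k}. 8 * real r * (if r < R0 then 1 else 4 * M ^ 4 / (M\<^sup>2 + (real r)\<^sup>2)\<^sup>2))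
    \<le> 8 * (real R0)\<^sup>2 + 16 * M\<^sup>2"
proof -
  \<comment> \<open>Its decrement is 2r / ((M^2 + r^2)^2 - r^2), just above the summand to be
    bounded, and \<open>w 0\<close> is 1/M^2.\<close>
  define w where "w r = 1 / (M\<^sup>2 + real r * (real r + 1))" for r :: nat
  have each: "8 * real r * (if r < R0 then 1 else 4 * M ^ 4 / (M\<^sup>2 + (real r)\<^sup>2)\<^sup>2) \<le>
      (if r < R0 then 8 * real R0 else 0) + 16 * M ^ 4 * (w (r - 1) - w r)" if "r \<in> {1..k}" for r
  proof -
    have "r \<ge> 1" using that by simp
    have "M\<^sup>2 > 0" using assms by simp
    have "w (r - 1) - w r = 1 / (M\<^sup>2 + (real r)\<^sup>2 - real r) - 1 / (M\<^sup>2 + (real r)\<^sup>2 + real r)"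
      using \<open>r \<ge> 1\<close> by (simp add: w_def of_nat_diff power2_eq_square algebra_simps)
    also have "\<dots> = 2 * real r / ((M\<^sup>2 + (real r)\<^sup>2)\<^sup>2 - (real r)\<^sup>2)"
    proof -
      have "(real r)\<^sup>2 \<ge> real r"
        using \<open>r \<ge> 1\<close> by (simp add: power2_eq_square)
      then have "M\<^sup>2 + (real r)\<^sup>2 - real r \<noteq> 0" "M\<^sup>2 + (real r)\<^sup>2 + real r \<noteq> 0"
        using \<open>M\<^sup>2 > 0\<close> by linarith+
      moreover have "(M\<^sup>2 + (real r)\<^sup>2)\<^sup>2 - (real r)\<^sup>2 = (M\<^sup>2 + (real r)\<^sup>2 - real r) * (M\<^sup>2 + (real r)\<^sup>2 + real r)"
        by (simp add: power2_eq_square algebra_simps)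
      ultimately show ?thesis
        by (simp add: field_simps)
    qed
    also have "\<dots> \<ge> 2 * real r / (M\<^sup>2 + (real r)\<^sup>2)\<^sup>2"
    proof (intro divide_left_mono mult_pos_pos)
      have "(real r)\<^sup>2 < (M\<^sup>2 + (real r)\<^sup>2)\<^sup>2"
      proof (rule power_strict_mono)
        have "real r \<le> (real r)\<^sup>2" using \<open>r \<ge> 1\<close> by (simp add: power2_eq_square)
        then show "real r < M\<^sup>2 + (real r)\<^sup>2" using \<open>M\<^sup>2 > 0\<close> by linarith
      qed auto
      then show "0 < (M\<^sup>2 + (real r)\<^sup>2)\<^sup>2 - (real r)\<^sup>2" by simp
      show "0 < (M\<^sup>2 + (real r)\<^sup>2)\<^sup>2" using \<open>M\<^sup>2 > 0\<close> by (simp add: add_pos_nonneg)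
    qed auto
    finally have w: "2 * real r / (M\<^sup>2 + (real r)\<^sup>2)\<^sup>2 \<le> w (r - 1) - w r" .
    then have "16 * M ^ 4 * (2 * real r / (M\<^sup>2 + (real r)\<^sup>2)\<^sup>2) \<le> 16 * M ^ 4 * (w (r - 1) - w r)"
      using assms by (intro mult_left_mono) auto
    moreover have "0 \<le> 16 * M ^ 4 * (2 * real r / (M\<^sup>2 + (real r)\<^sup>2)\<^sup>2)"
      using assms by simp
    moreover have "8 * real r * (4 * M ^ 4 / (M\<^sup>2 + (real r)\<^sup>2)\<^sup>2) =
        16 * M ^ 4 * (2 * real r / (M\<^sup>2 + (real r)\<^sup>2)\<^sup>2)"
      by simp
    moreover have "8 * real r \<le> 8 * real R0" if "r < R0"
      using that by simp
    ultimately show ?thesis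
      by (cases "r < R0") (simp_all only: if_True if_False add_0 mult_1_right)
  qed
  have tele: "(\<Sum>r\<in>{1..k}. 16 * M ^ 4 * (w (r - 1) - w r)) = 16 * M ^ 4 * (w 0 - w k)"
    by (induction k) (auto simp: algebra_simps)
  have "w k \<ge> 0" by (simp add: w_def)
  then have "16 * M ^ 4 * (w 0 - w k) \<le> 16 * M ^ 4 * w 0"
    using assms by (intro mult_left_mono) auto
  also have "\<dots> = 16 * M\<^sup>2"
    using assms by (simp add: w_def power2_eq_square power4_eq_xxxx)
  finally have 1: "(\<Sum>r\<in>{1..k}. 16 * M ^ 4 * (w (r - 1) - w r)) \<le> 16 * M\<^sup>2"
    unfolding tele .
  have "(\<Sum>r\<in>{1..k}. if r < R0 then 8 * real R0 else 0) = (\<Sum>r\<in>{r\<in>{1..k}. r < R0}. 8 * real R0)"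
    by (subst sum.inter_filter) auto
  also have "\<dots> = real (card {r\<in>{1..k}. r < R0}) * (8 * real R0)"
    by simp
  also have "\<dots> \<le> real R0 * (8 * real R0)"
  proof (intro mult_right_mono)
    have "card {r\<in>{1..k}. r < R0} \<le> card {..<R0}"
      by (rule card_mono) auto
    then show "real (card {r\<in>{1..k}. r < R0}) \<le> real R0" by simp
  qed simp
  finally have 2: "(\<Sum>r\<in>{1..k}. if r < R0 then 8 * real R0 else 0) \<le> 8 * (real R0)\<^sup>2"
    by (simp add: power2_eq_square)
  have "(\<Sum>r\<in>{1..k}. 8 * real r * (if r < R0 then 1 else 4 * M ^ 4 / (M\<^sup>2 + (real r)\<^sup>2)\<^sup>2)) \<le>
      (\<Sum>r\<in>{1..k}. (if r < R0 then 8 * real R0 else 0) + 16 * M ^ 4 * (w (r - 1) - w r))"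
    by (rule sum_mono[OF each])
  also have "\<dots> \<le> 8 * (real R0)\<^sup>2 + 16 * M\<^sup>2"
    unfolding sum.distrib using 1 2 by (rule add_mono[OF _ _, rotated])
  finally show ?thesis .
qed

context lattice_EDS
begin

text \<open>The cost is of order 1/L and the mass of order M^2. The plateau radius R0 must cover the
  cube with its forward neighbours and be at least 20 for the constant 431. The lone 1 in the mass
  is the origin.\<close>

lemma boundary_flux_le_planar:
  fixes R0 :: nat
  assumes "CARD('n) = 2"
    and u: "u \<in> topspace X" and "T > 0" "R \<ge> 1" "R0 \<ge> 20" "int R0 \<ge> R + 1" "M > 0"
    and L: "L = ln (1 + (M / real R0)\<^sup>2)" "L \<ge> 1"
    and \<beta>: "\<beta> \<ge> 0" "\<And>v. v \<in> topspace X \<Longrightarrow> b (norm (e v)) \<le> \<beta>"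
  shows "boundary_flux \<phi> f u R T \<le>
    \<beta> / 4 * (431 / L) * T + norm (e (\<phi> u 0)) * (1 + (8 * (real R0)\<^sup>2 + 16 * M\<^sup>2))"
proof (rule boundary_flux_le[OF u \<open>T > 0\<close> \<open>R \<ge> 1\<close> \<beta>])
  let ?\<theta> = "log_cutoff R0 M :: int ^ 'n \<Rightarrow> real"
  have P0: "log_profile R0 M 0 = L"
    using L by (simp add: log_profile_def)
  have pos: "log_profile R0 M s > 0" for s
    using assms by (intro log_profile_pos) auto
  show \<theta>_pos: "?\<theta> \<alpha> > 0" for \<alpha>
    using pos[of 0] pos[of "lattice_norm \<alpha>"] by (simp add: log_cutoff_def)
  show "?\<theta> \<alpha> = 1" if "\<alpha> \<in> lattice_box (- R + 1) (R + 1)" for \<alpha>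
  proof -
    have "\<alpha> \<in> lattice_box (- int R0) (int R0)"
      using that lattice_box_mono[of "- int R0" "- R + 1" "R + 1" "int R0"] assms by auto
    then have "max (lattice_norm \<alpha>) R0 = R0"
      using lattice_norm_le_iff[of \<alpha> R0] by simp
    then have "log_profile R0 M (lattice_norm \<alpha>) = log_profile R0 M 0"
      by (simp add: log_profile_def)
    then show ?thesis
      using pos[of 0] by (simp add: log_cutoff_def)
  qed
  show "sum ?\<theta> A \<le> 1 + (8 * (real R0)\<^sup>2 + 16 * M\<^sup>2)" if "finite A" for A
  proof (rule sum_lattice_norm_planar_le[OF \<open>CARD('n) = 2\<close> that])
    show "?\<theta> \<alpha> \<ge> 0" for \<alpha> using \<theta>_pos less_imp_le by blast
    show "?\<theta> \<alpha> \<le> (\<lambda>r. if r < R0 then 1 else 4 * M ^ 4 / (M\<^sup>2 + (real r)\<^sup>2)\<^sup>2) (lattice_norm \<alpha>)" for \<alpha>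
      using log_cutoff_le[of R0 M \<alpha>] assms P0 by simp
    show "(\<lambda>r. if r < R0 then 1 else 4 * M ^ 4 / (M\<^sup>2 + (real r)\<^sup>2)\<^sup>2) 0 +
        (\<Sum>r\<in>{1..k}. 8 * real r * (\<lambda>r. if r < R0 then 1 else 4 * M ^ 4 / (M\<^sup>2 + (real r)\<^sup>2)\<^sup>2) r)
        \<le> 1 + (8 * (real R0)\<^sup>2 + 16 * M\<^sup>2)" for k
      using sum_log_cutoff_bound[of R0 M k] assms by auto
  qed
  show "sum (cutoff_energy ?\<theta>) A \<le> 431 / L" if "finite A" for A
  proof (rule sum_lattice_norm_planar_le[OF \<open>CARD('n) = 2\<close> that])
    let ?P = "log_profile R0 M"
    show "cutoff_energy ?\<theta> \<alpha> \<ge> 0" for \<alpha>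
      using \<theta>_pos by (rule cutoff_energy_nonneg)
    show "cutoff_energy ?\<theta> \<alpha> \<le> (\<lambda>r. if r = 0 then 0 else
        2 * ((9 * (?P (r - 1) - ?P r)\<^sup>2 + 4 * (?P r - ?P (Suc r))\<^sup>2) / (?P 0)\<^sup>2)) (lattice_norm \<alpha>)" for \<alpha>
    proof (cases "lattice_norm \<alpha> = 0")
      \<comment> \<open>The shell sum omits the origin; nothing is lost, as both increments there
        lie on the plateau.\<close>
      case True
      have "?P (Suc 0) = ?P 0"
        using assms by (simp add: log_profile_def max_def)
      then show ?thesis
        using cutoff_energy_log_cutoff[of R0 M \<alpha>] assms True by simp
    next
      case False
      then show ?thesis
        using cutoff_energy_log_cutoff[of R0 M \<alpha>] assms by simp
    qed
    show "(\<lambda>r. if r = 0 then 0 else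
        2 * ((9 * (?P (r - 1) - ?P r)\<^sup>2 + 4 * (?P r - ?P (Suc r))\<^sup>2) / (?P 0)\<^sup>2)) 0 +
        (\<Sum>r\<in>{1..k}. 8 * real r * (\<lambda>r. if r = 0 then 0 else
        2 * ((9 * (?P (r - 1) - ?P r)\<^sup>2 + 4 * (?P r - ?P (Suc r))\<^sup>2) / (?P 0)\<^sup>2)) r) \<le> 431 / L" for k
    proof -
      have "(\<Sum>r\<in>{1..k}. 8 * real r * (\<lambda>r. if r = 0 then 0 else
        2 * ((9 * (?P (r - 1) - ?P r)\<^sup>2 + 4 * (?P r - ?P (Suc r))\<^sup>2) / (?P 0)\<^sup>2)) r) =
        (\<Sum>r\<in>{1..k}. 8 * real r *
          (2 * ((9 * (?P (r - 1) - ?P r)\<^sup>2 + 4 * (?P r - ?P (Suc r))\<^sup>2) / (?P 0)\<^sup>2)))"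
        by (rule sum.cong) auto
      then show ?thesis
        using sum_log_profile_energy[of R0 M k] assms P0 by simp
    qed
  qed
qed

end

section \<open>Long-time flux\<close>

lemma Limsup_le_of_tendsto:
  fixes g h :: "real \<Rightarrow> real"
  assumes "eventually (\<lambda>T. g T \<le> h T) at_top" "(h \<longlongrightarrow> l) at_top"
  shows "Limsup at_top (\<lambda>T. ereal (g T)) \<le> ereal l"
proof -
  have "Limsup at_top (\<lambda>T. ereal (g T)) \<le> Limsup at_top (\<lambda>T. ereal (h T))"
    using assms(1) by (intro Limsup_mono) simp
  also have "\<dots> = ereal l"
    using assms(2) by (intro lim_imp_Limsup) auto
  finally show ?thesis .
qed

text \<open>The planar limit is 431/4 * 10/9 = 431/(18/5), about 119.7, while sqrt 2 >= 1.4 already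
  gives 134.4.\<close>

lemma planar_constant: "(96::real) * sqrt 2 \<ge> 431 / (18 / 5)"
proof -
  have "(1.4::real) \<le> sqrt 2"
    by (rule real_le_rsqrt) (simp add: power2_eq_square)
  then show ?thesis by simp
qed

text \<open>A real supremum is an upper bound only for a set that is bounded above; boundedness of
  the energy and monotonicity of b ensure this.\<close>

lemma (in bounded_lattice_EDS) b_norm_energy_le_SUP:
  assumes "v \<in> topspace X"
  shows "b (norm (e v)) \<le> (SUP v\<in>topspace X. b (norm (e v)))"
proof (rule cSUP_upper[OF assms])
  obtain M where M: "\<And>v. v \<in> topspace X \<Longrightarrow> norm (e v) \<le> M"
    using bounded_energy by (auto simp: bdd_above_def)
  \<comment> \<open>Monotonicity of b is assumed only on nonnegative arguments, hence
    \<open>max 0 M\<close>.\<close>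
  have "b (norm (e v)) \<le> b (max 0 M)" if "v \<in> topspace X" for v
    using M[OF that] by (intro mono_onD[OF b_mono]) auto
  then show "bdd_above ((\<lambda>v. b (norm (e v))) ` topspace X)"
    by (auto simp: bdd_above_def)
qed

context lattice_EDS
begin

context
  fixes u :: 'x and \<beta> e0 :: real and R :: int
  assumes u: "u \<in> topspace X" and R: "R \<ge> 1"
    and \<beta>_upper: "\<And>v. v \<in> topspace X \<Longrightarrow> b (norm (e v)) \<le> \<beta>" and e0_def: "e0 = norm (e (\<phi> u 0))"
begin

lemma \<beta>_nonneg: "\<beta> \<ge> 0"
  using \<beta>_upper[OF u] b_nonneg[of "norm (e u)"] by simp

lemma e0_nonneg: "e0 \<ge> 0"
  by (simp add: e0_def)

text \<open>With tails of mass k sqrt T, cost and mass contribute \<beta>/(2k) and 2 e0 k after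
  division by sqrt T, and the plateau only O(1/sqrt T). The best k is sqrt \<beta> / (2 sqrt
  e0).\<close>

lemma limsup_flux_dim_1:
  assumes "CARD('n) = 1"
  shows "Limsup at_top (\<lambda>T. ereal (1 / sqrt T * boundary_flux \<phi> f u R T)) \<le> ereal (2 * sqrt (\<beta> * e0))"
proof -
  have *: "Limsup at_top (\<lambda>T. ereal (1 / sqrt T * boundary_flux \<phi> f u R T)) \<le> ereal (\<beta> / (2 * k) + 2 * e0 * k)"
    if "k > 0" for k
  proof (rule Limsup_le_of_tendsto)
    show "eventually (\<lambda>T. 1 / sqrt T * boundary_flux \<phi> f u R T \<le>
        \<beta> / (2 * k) + 2 * e0 * k + e0 * (2 * of_int R + 1) / sqrt T) at_top"
      using eventually_gt_at_top[of 0]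
    proof eventually_elim
      case (elim T)
      define s where "s = sqrt T"
      have s: "s > 0" "T = s\<^sup>2" using elim by (auto simp: s_def)
      have "boundary_flux \<phi> f u R T \<le> \<beta> / 4 * (1 / (k * s) + 1 / (1 + k * s)) * T
          + e0 * (2 * of_int R + 1 + 2 * (k * s))"
        using boundary_flux_le_product[OF u elim R _ \<beta>_nonneg \<beta>_upper, of "k * s"] assms s \<open>k > 0\<close>
        by (simp add: e0_def)
      also have "\<dots> \<le> \<beta> / 4 * (1 / (k * s) + 1 / (k * s)) * T + e0 * (2 * of_int R + 1 + 2 * (k * s))"
      proof (intro add_right_mono mult_right_mono mult_left_mono add_left_mono)
        show "1 / (1 + k * s) \<le> 1 / (k * s)"
          using s \<open>k > 0\<close> by (intro divide_left_mono) (auto simp: add_pos_pos)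
      qed (use \<beta>_nonneg elim in auto)
      also have "\<dots> = s * (\<beta> / (2 * k) + 2 * e0 * k + e0 * (2 * of_int R + 1) / s)"
        using s \<open>k > 0\<close> by (simp add: field_simps power2_eq_square)
      finally have "boundary_flux \<phi> f u R T / s \<le> \<beta> / (2 * k) + 2 * e0 * k + e0 * (2 * of_int R + 1) / s"
        using s by (simp only: pos_divide_le_eq mult.commute[of s])
      then show ?case
        by (simp add: s_def)
    qed
    show "((\<lambda>T. \<beta> / (2 * k) + 2 * e0 * k + e0 * (2 * of_int R + 1) / sqrt T) \<longlongrightarrow> \<beta> / (2 * k) + 2 * e0 * k) at_top"
    proof -
      have "((\<lambda>T::real. 1 / sqrt T) \<longlongrightarrow> 0) at_top" by real_asymp
      then have "((\<lambda>T. \<beta> / (2 * k) + 2 * e0 * k + e0 * (2 * of_int R + 1) * (1 / sqrt T)) \<longlongrightarrow>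
          \<beta> / (2 * k) + 2 * e0 * k + e0 * (2 * of_int R + 1) * 0) at_top"
        by (intro tendsto_intros)
      then show ?thesis by simp
    qed
  qed
  \<comment> \<open>The best k is 0 or undefined if \<beta> or e0 vanishes, so both are raised by
    \<epsilon>, which tends to 0 at the end.\<close>
  have le: "Limsup at_top (\<lambda>T. ereal (1 / sqrt T * boundary_flux \<phi> f u R T)) \<le>
      ereal (2 * sqrt ((\<beta> + \<epsilon>) * (e0 + \<epsilon>)))" if "\<epsilon> > 0" for \<epsilon>
  proof -
    define p q where "p = sqrt (\<beta> + \<epsilon>)" and "q = sqrt (e0 + \<epsilon>)"
    have pq: "p > 0" "q > 0" "p\<^sup>2 = \<beta> + \<epsilon>" "q\<^sup>2 = e0 + \<epsilon>"
      using \<beta>_nonneg e0_nonneg that by (auto simp: p_def q_def)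
    have "\<beta> / (2 * (p / (2 * q))) + 2 * e0 * (p / (2 * q)) \<le>
        p\<^sup>2 / (2 * (p / (2 * q))) + 2 * q\<^sup>2 * (p / (2 * q))"
      using pq that by (intro add_mono divide_right_mono mult_right_mono) auto
    also have "\<dots> = 2 * (p * q)"
      using pq(1,2) by (simp add: field_simps power2_eq_square)
    also have "p * q = sqrt ((\<beta> + \<epsilon>) * (e0 + \<epsilon>))"
      by (simp add: p_def q_def real_sqrt_mult)
    finally have "ereal (\<beta> / (2 * (p / (2 * q))) + 2 * e0 * (p / (2 * q))) \<le>
        ereal (2 * sqrt ((\<beta> + \<epsilon>) * (e0 + \<epsilon>)))"
      by simp
    then show ?thesis
      using *[of "p / (2 * q)"] pq by (meson divide_pos_pos mult_pos_pos order_trans zero_less_numeral)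
  qed
  have "((\<lambda>\<epsilon>. ereal (2 * sqrt ((\<beta> + \<epsilon>) * (e0 + \<epsilon>)))) \<longlongrightarrow> ereal (2 * sqrt ((\<beta> + 0) * (e0 + 0)))) (at_right 0)"
    by (intro tendsto_intros)
  then have "((\<lambda>\<epsilon>. ereal (2 * sqrt ((\<beta> + \<epsilon>) * (e0 + \<epsilon>)))) \<longlongrightarrow> ereal (2 * sqrt (\<beta> * e0))) (at_right 0)"
    by simp
  moreover have "eventually (\<lambda>\<epsilon>. Limsup at_top (\<lambda>T. ereal (1 / sqrt T * boundary_flux \<phi> f u R T)) \<le>
      ereal (2 * sqrt ((\<beta> + \<epsilon>) * (e0 + \<epsilon>)))) (at_right (0::real))"
    using le eventually_at_right_less by (rule eventually_mono[rotated])
  ultimately show ?thesis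
    by (rule tendsto_lowerbound) simp
qed

text \<open>
  The exponent \<open>9/20\<close> of the cutoff scale \<open>M\<close> must be below \<open>1/2\<close>, so that \<open>e\<^sub>0 M\<^sup>2\<close> is negligible against
  \<open>T / ln T\<close>, and large enough for the resulting constant \<open>431 / (18/5)\<close> to stay below \<open>96 \<surd>2\<close>.
\<close>

lemma limsup_flux_dim_2:
  assumes "CARD('n) = 2"
  shows "Limsup at_top (\<lambda>T. ereal (ln T / T * boundary_flux \<phi> f u R T)) \<le> ereal (96 * sqrt 2 * \<beta>)"
proof -
  define R0 where "R0 = nat R + 20"
  define c where "c = real R0"
  have c: "c > 0" by (simp add: c_def R0_def)
  define L where "L T = ln (1 + (T powr (9 / 20) / c)\<^sup>2)" for T
  define S where "S T = 1 + (8 * c\<^sup>2 + 16 * (T powr (9 / 20))\<^sup>2)" for T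
  have "Limsup at_top (\<lambda>T. ereal (ln T / T * boundary_flux \<phi> f u R T)) \<le> ereal (\<beta> * (431 / 4) * (10 / 9) + e0 * 0)"
  proof (rule Limsup_le_of_tendsto)
    have "eventually (\<lambda>T. L T \<ge> 1) at_top"
      unfolding L_def using c by real_asymp
    then show "eventually (\<lambda>T. ln T / T * boundary_flux \<phi> f u R T \<le>
        \<beta> * (431 / 4) * (ln T / L T) + e0 * (ln T / T * S T)) at_top"
      using eventually_gt_at_top[of 1]
    proof eventually_elim
      case (elim T)
      have "boundary_flux \<phi> f u R T \<le> \<beta> / 4 * (431 / L T) * T + e0 * S T"
        unfolding e0_def S_def c_def using assms u elim R \<beta>_nonneg \<beta>_upper
        by (intro boundary_flux_le_planar) (auto simp: R0_def L_def c_def)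
      then have "ln T / T * boundary_flux \<phi> f u R T \<le> ln T / T * (\<beta> / 4 * (431 / L T) * T + e0 * S T)"
        using elim by (intro mult_left_mono) auto
      also have "\<dots> = \<beta> * (431 / 4) * (ln T / L T) + e0 * (ln T / T * S T)"
        using elim by (simp add: field_simps)
      finally show ?case .
    qed
    \<comment> \<open>The argument of the logarithm in L grows like T^(9/10), so L T is asymptotic
      to (9/10) ln T.\<close>
    have "((\<lambda>T. ln T / L T) \<longlongrightarrow> 10 / 9) at_top"
      unfolding L_def using c by real_asymp
    moreover have "((\<lambda>T. ln T / T * S T) \<longlongrightarrow> 0) at_top"
      unfolding S_def using c by real_asymp
    ultimately show "((\<lambda>T. \<beta> * (431 / 4) * (ln T / L T) + e0 * (ln T / T * S T)) \<longlongrightarrow>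
        \<beta> * (431 / 4) * (10 / 9) + e0 * 0) at_top"
      by (intro tendsto_add tendsto_mult tendsto_const)
  qed
  also have "\<beta> * (431 / 4) * (10 / 9) + e0 * 0 \<le> 96 * sqrt 2 * \<beta>"
    using mult_right_mono[OF planar_constant \<beta>_nonneg] by simp
  finally show ?thesis by simp
qed

text \<open>The cutoff does not depend on T, so the mass term disappears after division by T and
  only the cost remains.\<close>

lemma limsup_flux_dim_ge_3:
  assumes "CARD('n) \<ge> 3"
  shows "Limsup at_top (\<lambda>T. ereal (1 / T * boundary_flux \<phi> f u R T)) \<le>
    ereal (real CARD('n) powr (5 / 2) * 2 ^ (2 * CARD('n) - 2) * \<beta> * real_of_int R ^ (CARD('n) - 2))"
proof -
  define N where "N = CARD('n)"
  define r where "r = real_of_int R"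
  have r: "r \<ge> 1" using R by (simp add: r_def)
  define M where "M = N - 2"
  have M: "N = M + 2" "M \<ge> 1"
    using assms by (auto simp: M_def N_def)
  \<comment> \<open>The tail mass r - 1/2 makes W equal to 4r.\<close>
  define a where "a = \<beta> / 4 * (real N * ((1 / (r - 1 / 2) + 1 / (1 + (r - 1 / 2))) * (4 * r) ^ (N - 1)))"
  have bound: "boundary_flux \<phi> f u R T \<le> a * T + e0 * (4 * r) ^ N" if "T > 0" for T
  proof -
    have "2 * r + 1 + 2 * (r - 1 / 2) = 4 * r" by simp
    then show ?thesis
      using boundary_flux_le_product[OF u that R _ \<beta>_nonneg \<beta>_upper, of "r - 1 / 2"] r
      unfolding a_def N_def e0_def r_def by simp
  qed
  have "Limsup at_top (\<lambda>T. ereal (1 / T * boundary_flux \<phi> f u R T)) \<le> ereal (a + e0 * (4 * r) ^ N * 0)"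
  proof (rule Limsup_le_of_tendsto)
    show "eventually (\<lambda>T. 1 / T * boundary_flux \<phi> f u R T \<le> a + e0 * (4 * r) ^ N * (1 / T)) at_top"
      using eventually_gt_at_top[of 0]
    proof eventually_elim
      case (elim T)
      then show ?case using bound[OF elim] by (simp add: field_simps)
    qed
    have "((\<lambda>T::real. 1 / T) \<longlongrightarrow> 0) at_top" by real_asymp
    then show "((\<lambda>T. a + e0 * (4 * r) ^ N * (1 / T)) \<longlongrightarrow> a + e0 * (4 * r) ^ N * 0) at_top"
      by (intro tendsto_intros)
  qed
  also have "a \<le> real N powr (5 / 2) * 2 ^ (2 * N - 2) * \<beta> * r ^ (N - 2)"
  proof -
    \<comment> \<open>The two terms add up to at most 3; the rounded value 4 cancels the denominator
      of \<beta>/4. The result N * 4^(N-1) is then enlarged to the stated constant by N <=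
      N^(5/2).\<close>
    have "r / (r - 1 / 2) \<le> 2" "r / (1 + (r - 1 / 2)) \<le> 1"
      using r by (auto simp: field_simps)
    then have "r / (r - 1 / 2) + r / (1 + (r - 1 / 2)) \<le> 4" by linarith
    then have "(1 / (r - 1 / 2) + 1 / (1 + (r - 1 / 2))) * r \<le> 4"
      by (simp add: distrib_right)
    then have "\<beta> / 4 * (real N * (4 ^ (N - 1) * r ^ M * ((1 / (r - 1 / 2) + 1 / (1 + (r - 1 / 2))) * r))) \<le>
        \<beta> / 4 * (real N * (4 ^ (N - 1) * r ^ M * 4))"
      using \<beta>_nonneg r by (intro mult_left_mono) auto
    moreover have "a = \<beta> / 4 * (real N * (4 ^ (N - 1) * r ^ M * ((1 / (r - 1 / 2) + 1 / (1 + (r - 1 / 2))) * r)))"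
      by (simp add: a_def M power_mult_distrib algebra_simps)
    ultimately have "a \<le> real N * 4 ^ (N - 1) * \<beta> * r ^ M"
      by (simp add: algebra_simps)
    also have "\<dots> \<le> real N powr (5 / 2) * 4 ^ (N - 1) * \<beta> * r ^ M"
    proof -
      have "real N powr 1 \<le> real N powr (5 / 2)"
        using M by (intro powr_mono) auto
      then show ?thesis
        using \<beta>_nonneg r M by (intro mult_right_mono) auto
    qed
    also have "(4::real) ^ (N - 1) = 2 ^ (2 * (N - 1))"
      by (simp add: power_mult)
    also have "2 * (N - 1) = 2 * N - 2"
      by simp
    finally show ?thesis using M by simp
  qed
  finally show ?thesis
    by (simp add: N_def r_def)
qed

end

end

theorem corollary2:
  fixes X :: "'x topology"
    and \<phi> :: "'x \<Rightarrow> real \<Rightarrow> 'x"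
    and e d :: "'x \<Rightarrow> ((int ^ 'n) \<Rightarrow>\<^sub>C real)"
    and f :: "'x \<Rightarrow> ((int ^ 'n) \<Rightarrow>\<^sub>C (real ^ 'n))"
    and b :: "real \<Rightarrow> real"
    and u :: 'x
    and \<beta> e0 :: real
    and R :: int
  assumes "bounded_lattice_EDS X \<phi> e d f b"
    and "\<beta> = (SUP v\<in>topspace X. b (norm (e v)))"
    and "u \<in> topspace X"
    and "e0 = norm (e (\<phi> u 0))"
    and "R \<ge> 1"
  shows "(CARD('n) = 1 \<longrightarrow>
            Limsup at_top (\<lambda>T::real. ereal (1 / sqrt T * boundary_flux \<phi> f u R T))
              \<le> ereal (2 * sqrt (\<beta> * e0))) \<and>
         (CARD('n) = 2 \<longrightarrow>
            Limsup at_top (\<lambda>T::real. ereal (ln T / T * boundary_flux \<phi> f u R T))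
              \<le> ereal (96 * sqrt 2 * \<beta>)) \<and>
         (CARD('n) \<ge> 3 \<longrightarrow>
            Limsup at_top (\<lambda>T::real. ereal (1 / T * boundary_flux \<phi> f u R T))
              \<le> ereal (real CARD('n) powr (5 / 2) * 2 ^ (2 * CARD('n) - 2) * \<beta>
                        * real_of_int R ^ (CARD('n) - 2)))"
proof -
  interpret bounded_lattice_EDS X \<phi> e d f b by fact
  have "b (norm (e v)) \<le> \<beta>" if "v \<in> topspace X" for v
    unfolding assms(2) using that by (rule b_norm_energy_le_SUP)
  note facts = assms(3,5) this assms(4)
  show ?thesis
    using limsup_flux_dim_1[OF facts] limsup_flux_dim_2[OF facts] limsup_flux_dim_ge_3[OF facts]
    by blast
qed

end
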